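(* Let $n\geq 4$ be an even integer. Then every $(n-2)$-regular graph with $n$ vertices is (isomorphic to) the character degree graph $\Delta(G)$ of some finite solvable group $G$.
   Context: For a finite group $G$, $Irr(G)$ is the set of complex irreducible characters of $G$, $cd(G)=\{\chi(1)\mid \chi\in Irr(G)\}$, and $\rho(G)$ is the set of all primes that divide some element of $cd(G)$. The character degree graph $\Delta(G)$ is the simple undirected graph with vertex set $\rho(G)$ in which two distinct primes $p,q$ are adjacent if and only if $pq$ divides some element of $cd(G)$. All graphs are finite, simple and undirected. A graph is $k$-regular if every vertex has degree $k$. *)

theory Defs
  imports
    "HOL-Algebra.Solvable_Groups"
    "HOL-Computational_Algebra.Primes"
    "Jordan_Normal_Form.VS_Connect"
    "Graph_Theory.Graph_Theory"
begin

abbreviation GL_complex :: "nat \<Rightarrow> complex mat monoid" where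
  "GL_complex n \<equiv> units_of (ring_mat TYPE(complex) n ())"

abbreviation complex_space :: "nat \<Rightarrow> (complex, complex vec) module" where
  "complex_space n \<equiv> module_vec TYPE(complex) n"

definition complex_rep :: "('a, 'b) monoid_scheme \<Rightarrow> nat \<Rightarrow> ('a \<Rightarrow> complex mat) \<Rightarrow> bool" where
  "complex_rep G n R \<longleftrightarrow> R \<in> hom G (GL_complex n)"

text \<open>The zero representation (degree \<open>n = 0\<close>) does not count as irreducible.\<close>

definition irreducible_rep :: "('a, 'b) monoid_scheme \<Rightarrow> nat \<Rightarrow> ('a \<Rightarrow> complex mat) \<Rightarrow> bool" where
  "irreducible_rep G n R \<longleftrightarrow>
     complex_rep G n R \<and> n > 0 \<and>
     (\<forall>W. VectorSpace.subspace class_ring W (complex_space n) \<and>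
          (\<forall>g\<in>carrier G. \<forall>w\<in>W. R g *\<^sub>v w \<in> W)
        \<longrightarrow> W = {0\<^sub>v n} \<or> W = carrier_vec n)"

definition mat_trace :: "'a :: comm_monoid_add mat \<Rightarrow> 'a" where
  "mat_trace A = (\<Sum>i<dim_row A. A $$ (i, i))"

text \<open>Characters are functions on the carrier, so the values outside it are
  fixed to \<open>undefined\<close> by \<open>restrict\<close>.\<close>

definition character_of :: "('a, 'b) monoid_scheme \<Rightarrow> ('a \<Rightarrow> complex mat) \<Rightarrow> 'a \<Rightarrow> complex" where
  "character_of G R = restrict (\<lambda>g. mat_trace (R g)) (carrier G)"

definition Irr :: "('a, 'b) monoid_scheme \<Rightarrow> ('a \<Rightarrow> complex) set" where
  "Irr G = {character_of G R | n R. irreducible_rep G n R}"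

text \<open>Character values at the identity are complex numbers of the form \<open>of_nat d\<close>;
  the degree set collects the natural numbers \<open>d\<close>.\<close>

definition cd :: "('a, 'b) monoid_scheme \<Rightarrow> nat set" where
  "cd G = {d. \<exists>\<chi>\<in>Irr G. \<chi> \<one>\<^bsub>G\<^esub> = of_nat d}"

definition rho :: "('a, 'b) monoid_scheme \<Rightarrow> nat set" where
  "rho G = {p. prime p \<and> (\<exists>d\<in>cd G. p dvd d)}"

text \<open>Following \<open>Graph_Theory\<close>, an undirected edge is a pair of opposite arcs.\<close>

definition degree_graph :: "('a, 'b) monoid_scheme \<Rightarrow> nat pair_pre_digraph" where
  "degree_graph G =
     \<lparr> pverts = rho G,
       parcs = {(p, q). p \<in> rho G \<and> q \<in> rho G \<and> p \<noteq> q \<and> (\<exists>d\<in>cd G. p * q dvd d)} \<rparr>"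

text \<open>In a symmetric digraph without parallel arcs, the out-degree of a vertex is its
  number of neighbours.\<close>

definition regular_graph :: "nat \<Rightarrow> 'v pair_pre_digraph \<Rightarrow> bool" where
  "regular_graph k \<Gamma> \<longleftrightarrow> (\<forall>v\<in>pverts \<Gamma>. out_degree (with_proj \<Gamma>) v = k)"

end

theory Submission
  imports Defs "HOL-Algebra.Weak_Morphisms" "HOL-Algebra.Multiplicative_Group"
    "HOL-Number_Theory.Pocklington" "HOL-Computational_Algebra.Squarefree"
    "HOL-Computational_Algebra.Fundamental_Theorem_Algebra"
begin

text \<open>
  An \<open>(n - 2)\<close>-regular graph on \<open>n\<close> vertices is a complete graph with a perfect matching removed: every
  vertex has exactly one non-neighbour, and being non-neighbours pairs the vertices off. It is therefore
  the join of \<open>n / 2\<close> copies of the graph with two isolated vertices. Two isolated vertices \<open>p, q\<close> arise as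
  the degree graph of \<open>P \<rtimes> C\<^sub>q\<close>, where \<open>P\<close> is the Heisenberg group over the field with \<open>p\<close> elements,
  \<open>q\<close> divides \<open>p - 1\<close>, and \<open>C\<^sub>q\<close> acts on the two noncentral coordinates by \<open>a\<close> and \<open>a\<inverse>\<close> for an element \<open>a\<close>
  of order \<open>q\<close>: its irreducible degrees are \<open>1, p, q\<close>. A direct product of such groups for disjoint pairs
  \<open>(p\<^sub>i, q\<^sub>i)\<close> has the products of one degree from each factor as its degrees, which realises the join.

  Instead of forming direct products and their tensor product representations, the proof works with the
  product directly. By the Chinese remainder theorem it is the Heisenberg group over the integers modulo
  \<open>N = \<Prod>i. p\<^sub>i\<close>, extended by the cyclic group generated by a unit \<open>u\<close> that has order \<open>q\<^sub>i\<close> modulo every \<open>p\<^sub>i\<close>.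
  What has to be known about its degrees is only this: they contain \<open>(\<Prod>i\<in>I - T. p\<^sub>i) * (\<Prod>i\<in>T. q\<^sub>i)\<close> for every
  set \<open>T\<close> of indices (\<open>degree_in_cd\<close>), and each of them divides one of these numbers (\<open>degree_bound\<close>). Then
  the primes involved are the \<open>p\<^sub>i\<close> and \<open>q\<^sub>i\<close>, and the only two that never divide a common degree are the
  partners \<open>p\<^sub>i\<close> and \<open>q\<^sub>i\<close>.

  Both facts about degrees rest on one observation: simultaneous eigenvectors of a family of operators that
  belong to distinct systems of eigenvalues can be separated inside every invariant subspace
  (\<open>weight_components_in_subspace\<close>). Hence a monomial representation with distinct weights and a
  transitive permutation of its basis is irreducible (\<open>monomial_rep_irreducible\<close>). Conversely the
  dimension of an irreducible representation is the number of lines in the orbit of a suitable common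
  eigenvector (\<open>irreducible_degree_eq_transversal\<close>), an elementary form of the Clifford correspondence for
  a one-dimensional weight space.
\<close>

section \<open>Invariant subspaces and eigenvectors\<close>


abbreviation lin_subspace :: "nat \<Rightarrow> complex vec set \<Rightarrow> bool" where
  "lin_subspace n W \<equiv> VectorSpace.subspace class_ring W (complex_space n)"

lemma lin_subspace_iff:
  "lin_subspace n W \<longleftrightarrow> W \<subseteq> carrier_vec n \<and> 0\<^sub>v n \<in> W \<and>
     (\<forall>v\<in>W. \<forall>w\<in>W. v + w \<in> W) \<and> (\<forall>c. \<forall>v\<in>W. c \<cdot>\<^sub>v v \<in> W)"
  unfolding VectorSpace.subspace_def submodule_def
  using vec_vs[where 'a = complex] vec_module[where 'a = complex]
  by (auto simp: module_vec_simps class_ring_simps)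

lemma mult_mat_vec_index_sum:
  assumes "A \<in> carrier_mat n n" "v \<in> carrier_vec n" "k < n"
  shows "(A *\<^sub>v v) $ k = (\<Sum>m<n. A $$ (k, m) * v $ m)"
  using assms by (auto simp: scalar_prod_def lessThan_atLeast0 intro!: sum.cong)

lemma smult_vec_cancel:
  assumes "w \<in> carrier_vec n" "w \<noteq> 0\<^sub>v n"
  shows "a \<cdot>\<^sub>v w = b \<cdot>\<^sub>v w \<longleftrightarrow> a = (b :: complex)"
proof
  assume eq: "a \<cdot>\<^sub>v w = b \<cdot>\<^sub>v w"
  obtain k where k: "k < n" "w $ k \<noteq> 0"
  proof (rule ccontr)
    assume "\<not> thesis"
    hence "w = 0\<^sub>v n" using assms that by (intro eq_vecI) auto
    thus False using assms by auto
  qed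
  have "(a \<cdot>\<^sub>v w) $ k = (b \<cdot>\<^sub>v w) $ k" using eq by simp
  thus "a = b" using k assms by auto
qed auto

text \<open>
  By induction on the number of components: applying \<open>M b - l b j\<close> kills the component with index \<open>j\<close> and
  rescales every other component \<open>w i\<close> by \<open>l b i - l b j\<close>, and some \<open>b\<close> makes that factor nonzero.
\<close>
lemma weight_components_in_subspace:
  assumes "finite I" and W: "lin_subspace n W"
    and w: "\<And>i. i \<in> I \<Longrightarrow> w i \<in> carrier_vec n"
    and v: "v \<in> W" "\<And>k. k < n \<Longrightarrow> v $ k = (\<Sum>i\<in>I. w i $ k)"
    and B: "\<And>b. b \<in> B \<Longrightarrow> M b \<in> carrier_mat n n" "\<And>b x. b \<in> B \<Longrightarrow> x \<in> W \<Longrightarrow> M b *\<^sub>v x \<in> W"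
    and l: "\<And>b i. b \<in> B \<Longrightarrow> i \<in> I \<Longrightarrow> M b *\<^sub>v w i = l b i \<cdot>\<^sub>v w i"
    and sep: "\<And>i j. i \<in> I \<Longrightarrow> j \<in> I \<Longrightarrow> i \<noteq> j \<Longrightarrow> \<exists>b\<in>B. l b i \<noteq> l b j"
  shows "\<forall>i\<in>I. w i \<in> W"
  using assms(1) w v l sep
proof (induction I arbitrary: w v rule: finite_induct)
  case empty
  then show ?case by simp
next
  case (insert j F)
  have Wc: "W \<subseteq> carrier_vec n" and Wadd: "\<And>x y. x \<in> W \<Longrightarrow> y \<in> W \<Longrightarrow> x + y \<in> W"
    and Wsm: "\<And>c x. x \<in> W \<Longrightarrow> c \<cdot>\<^sub>v x \<in> W" using W unfolding lin_subspace_iff by auto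
  have vc: "v \<in> carrier_vec n" using insert.prems(2) Wc by auto
  have dimw: "dim_vec (w i) = n" if "i \<in> insert j F" for i using insert.prems(1)[OF that] by auto
  have wF: "w i \<in> W" if i: "i \<in> F" for i
  proof -
    have "i \<noteq> j" using i insert.hyps by auto
    then obtain b where b: "b \<in> B" "l b i \<noteq> l b j" using insert.prems(5)[of i j] i by auto
    have bc: "M b \<in> carrier_mat n n" using B b by auto
    define v' where "v' = M b *\<^sub>v v + (- l b j) \<cdot>\<^sub>v v"
    have v'W: "v' \<in> W" unfolding v'_def using b insert.prems(2) B Wadd Wsm by auto
    have v'k: "v' $ k = (\<Sum>i\<in>F. ((l b i - l b j) \<cdot>\<^sub>v w i) $ k)" if k: "k < n" for k
    proof -
      have "(M b *\<^sub>v v) $ k = (\<Sum>m<n. M b $$ (k, m) * (\<Sum>i\<in>insert j F. w i $ m))"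
        using mult_mat_vec_index_sum[OF bc vc k] insert.prems(3) by simp
      also have "\<dots> = (\<Sum>i\<in>insert j F. \<Sum>m<n. M b $$ (k, m) * w i $ m)"
        by (subst sum.swap) (simp add: sum_distrib_left)
      also have "\<dots> = (\<Sum>i\<in>insert j F. (M b *\<^sub>v w i) $ k)"
        using mult_mat_vec_index_sum[OF bc _ k] insert.prems(1) by (intro sum.cong) auto
      also have "\<dots> = (\<Sum>i\<in>insert j F. l b i * w i $ k)"
        using dimw insert.prems(4) b k by (intro sum.cong) auto
      finally have 1: "(M b *\<^sub>v v) $ k = (\<Sum>i\<in>insert j F. l b i * w i $ k)" .
      have "v' $ k = (M b *\<^sub>v v) $ k - l b j * v $ k"
        unfolding v'_def using k vc bc by simp
      also have "\<dots> = (\<Sum>i\<in>insert j F. (l b i - l b j) * w i $ k)"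
        unfolding 1 insert.prems(3)[OF k] by (simp only: sum_distrib_left sum_subtractf left_diff_distrib)
      also have "\<dots> = (\<Sum>i\<in>F. (l b i - l b j) * w i $ k)" using insert.hyps by simp
      also have "\<dots> = (\<Sum>i\<in>F. ((l b i - l b j) \<cdot>\<^sub>v w i) $ k)"
        using dimw k by (intro sum.cong) auto
      finally show ?thesis .
    qed
    have "\<forall>i\<in>F. (l b i - l b j) \<cdot>\<^sub>v w i \<in> W"
    proof (rule insert.IH[OF _ v'W v'k])
      fix c i assume c: "c \<in> B" and i: "i \<in> F"
      have "M c *\<^sub>v ((l b i - l b j) \<cdot>\<^sub>v w i) = (l b i - l b j) \<cdot>\<^sub>v (l c i \<cdot>\<^sub>v w i)"
        using mult_mat_vec[OF B(1)[OF c], of "w i"] insert.prems(1)[of i] insert.prems(4)[of c i] c i by auto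
      thus "M c *\<^sub>v ((l b i - l b j) \<cdot>\<^sub>v w i) = l c i \<cdot>\<^sub>v ((l b i - l b j) \<cdot>\<^sub>v w i)"
        by (simp add: smult_smult_assoc mult.commute)
    qed (use insert.prems in auto)
    hence "inverse (l b i - l b j) \<cdot>\<^sub>v ((l b i - l b j) \<cdot>\<^sub>v w i) \<in> W" using i Wsm by blast
    thus ?thesis using b by (simp add: smult_smult_assoc)
  qed
  have sumF: "\<exists>u\<in>W. \<forall>k<n. u $ k = (\<Sum>i\<in>E. w i $ k)" if "E \<subseteq> F" for E
    using finite_subset[OF that insert.hyps(1)] that
  proof (induction E rule: finite_induct)
    case empty
    then show ?case using W unfolding lin_subspace_iff by (intro bexI[of _ "0\<^sub>v n"]) auto
  next
    case (insert a E)
    then obtain u where u: "u \<in> W" "\<forall>k<n. u $ k = (\<Sum>i\<in>E. w i $ k)" by auto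
    have "w a \<in> W" using wF insert by auto
    hence "w a + u \<in> W" "w a \<in> carrier_vec n" "u \<in> carrier_vec n" using u Wadd Wc by auto
    then show ?case using u(2) insert by (intro bexI[of _ "w a + u"]) auto
  qed
  obtain u where u: "u \<in> W" "\<forall>k<n. u $ k = (\<Sum>i\<in>F. w i $ k)" using sumF by blast
  have "w j = v + (-1) \<cdot>\<^sub>v u"
    using insert.prems(1)[of j] insert.prems(3) u Wc vc insert.hyps by (intro eq_vecI) auto
  hence "w j \<in> W" using u Wadd Wsm insert.prems(2) by auto
  thus ?case using wF by auto
qed

text \<open>
  The vector \<open>p(A) v\<close> by Horner's scheme, so that no powers of the matrix \<open>A\<close> and no sums of vectors are
  formed.
\<close>
definition poly_apply :: "complex mat \<Rightarrow> complex poly \<Rightarrow> complex vec \<Rightarrow> complex vec" where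
  "poly_apply A p v = fold_coeffs (\<lambda>c w. c \<cdot>\<^sub>v v + A *\<^sub>v w) p (0\<^sub>v (dim_vec v))"

lemma poly_apply_0: "v \<in> carrier_vec n \<Longrightarrow> poly_apply A 0 v = 0\<^sub>v n"
  by (auto simp: poly_apply_def)

lemma poly_apply_pCons:
  assumes "A \<in> carrier_mat n n" "v \<in> carrier_vec n"
  shows "poly_apply A (pCons c p) v = c \<cdot>\<^sub>v v + A *\<^sub>v poly_apply A p v"
proof (cases "c = 0 \<and> p = 0")
  case True
  have "A *\<^sub>v 0\<^sub>v n = 0\<^sub>v n" using assms by auto
  with True show ?thesis using assms by (auto simp: poly_apply_def)
next
  case False
  then show ?thesis by (auto simp: poly_apply_def fold_coeffs_pCons_not_0_0_eq)
qed

lemma poly_apply_carrier: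
  assumes "A \<in> carrier_mat n n" "v \<in> carrier_vec n"
  shows "poly_apply A p v \<in> carrier_vec n"
  by (induction p) (use assms in \<open>auto simp: poly_apply_0 poly_apply_pCons\<close>)

lemma poly_apply_in_subspace:
  assumes "A \<in> carrier_mat n n" "lin_subspace n W" "\<And>x. x \<in> W \<Longrightarrow> A *\<^sub>v x \<in> W" "v \<in> W"
  shows "poly_apply A p v \<in> W"
proof -
  have "v \<in> carrier_vec n" using assms unfolding lin_subspace_iff by auto
  thus ?thesis using assms unfolding lin_subspace_iff
    by (induction p) (auto simp: poly_apply_0 poly_apply_pCons)
qed

lemma poly_apply_linear_factor:
  assumes A: "A \<in> carrier_mat n n" and v: "v \<in> carrier_vec n"
  shows "poly_apply A ([:- a, 1:] * q) v = A *\<^sub>v poly_apply A q v + (- a) \<cdot>\<^sub>v poly_apply A q v"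
proof -
  have c: "poly_apply A p v \<in> carrier_vec n" for p using poly_apply_carrier[OF assms] .
  have add: "poly_apply A (p + q) v = poly_apply A p v + poly_apply A q v" for p q
  proof (induction p q rule: poly_induct2)
    case 0
    then show ?case using v by (simp add: poly_apply_0)
  next
    case (pCons a p b q)
    have "A *\<^sub>v (poly_apply A p v + poly_apply A q v) = A *\<^sub>v poly_apply A p v + A *\<^sub>v poly_apply A q v"
      using mult_add_distrib_mat_vec[OF A c c] .
    then show ?case using pCons v A c
      by (intro eq_vecI) (auto simp: poly_apply_pCons[OF assms] algebra_simps carrier_vecD)
  qed
  have sm: "poly_apply A (Polynomial.smult b p) v = b \<cdot>\<^sub>v poly_apply A p v" for b p
  proof (induction p)
    case 0
    have "b \<cdot>\<^sub>v 0\<^sub>v n = 0\<^sub>v n" by (intro eq_vecI) auto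
    then show ?case using v by (simp add: poly_apply_0)
  next
    case (pCons a p)
    then show ?case using v A c mult_mat_vec[OF A c, of b p]
      by (auto simp: poly_apply_pCons[OF assms] smult_add_distrib_vec[of _ n] smult_smult_assoc)
  qed
  have eq: "[:- a, 1:] * q = Polynomial.smult (- a) q + pCons 0 q" by simp
  have "A *\<^sub>v poly_apply A q v \<in> carrier_vec n" using A c by auto
  thus ?thesis
    unfolding eq add sm poly_apply_pCons[OF assms, of 0 q] using v c[of q] A
    by (intro eq_vecI) auto
qed

text \<open>
  Split off a linear factor \<open>X - a\<close> of \<open>p\<close>, leaving \<open>q\<close>. Either \<open>q\<close> already annihilates \<open>v\<close>, or \<open>q(A) v\<close> is
  an eigenvector for \<open>a\<close>. Unlike an eigenvector obtained from the
  characteristic polynomial of \<open>A\<close>, this one lies in the prescribed subspace \<open>W\<close>.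
\<close>
lemma eigenvector_if_poly_kills:
  assumes A: "A \<in> carrier_mat n n" and W: "lin_subspace n W" "\<And>x. x \<in> W \<Longrightarrow> A *\<^sub>v x \<in> W"
    and v: "v \<in> W" "v \<noteq> 0\<^sub>v n" and p: "p \<noteq> 0" "poly_apply A p v = 0\<^sub>v n"
  shows "\<exists>w\<in>W. w \<noteq> 0\<^sub>v n \<and> (\<exists>c. A *\<^sub>v w = c \<cdot>\<^sub>v w)"
  using p
proof (induction "degree p" arbitrary: p rule: less_induct)
  case (less p)
  have vc: "v \<in> carrier_vec n" using v W unfolding lin_subspace_iff by auto
  show ?case
  proof (cases "degree p = 0")
    case True
    then obtain c where c: "p = [:c:]" using degree_eq_zeroE by blast
    have "A *\<^sub>v 0\<^sub>v n = 0\<^sub>v n" using A by auto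
    with c have "c \<noteq> 0" "poly_apply A p v = c \<cdot>\<^sub>v v"
      using less.prems poly_apply_pCons[OF A vc, of c 0] poly_apply_0[OF vc, of A] A vc by auto
    hence "c \<cdot>\<^sub>v v = 0\<^sub>v n" using less.prems by simp
    hence "inverse c \<cdot>\<^sub>v (c \<cdot>\<^sub>v v) = 0\<^sub>v n" by auto
    hence False using \<open>c \<noteq> 0\<close> v by (simp add: smult_smult_assoc)
    thus ?thesis ..
  next
    case False
    then obtain a where "poly p a = 0"
      using fundamental_theorem_of_algebra[of p] by (auto simp: constant_degree)
    then obtain q where q: "p = [:- a, 1:] * q" by (auto simp: poly_eq_0_iff_dvd)
    hence q0: "q \<noteq> 0" using less.prems by auto
    hence deg: "degree q < degree p" unfolding q by (subst degree_mult_eq) auto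
    show ?thesis
    proof (cases "poly_apply A q v = 0\<^sub>v n")
      case True
      thus ?thesis using less.hyps[OF deg q0] by simp
    next
      case False
      let ?w = "poly_apply A q v"
      have wW: "?w \<in> W" using poly_apply_in_subspace[OF A W v(1)] .
      hence wc: "?w \<in> carrier_vec n" using W unfolding lin_subspace_iff by auto
      have "A *\<^sub>v ?w + (- a) \<cdot>\<^sub>v ?w = 0\<^sub>v n"
        using less.prems poly_apply_linear_factor[OF A vc, of a q] q by simp
      hence eq: "(A *\<^sub>v ?w + (- a) \<cdot>\<^sub>v ?w) $ k = 0" if "k < n" for k using that by simp
      have "A *\<^sub>v ?w = a \<cdot>\<^sub>v ?w"
      proof (rule eq_vecI)
        fix k assume "k < dim_vec (a \<cdot>\<^sub>v ?w)"
        thus "(A *\<^sub>v ?w) $ k = (a \<cdot>\<^sub>v ?w) $ k" using eq[of k] wc A by simp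
      qed (use A wc in auto)
      thus ?thesis using False wW by auto
    qed
  qed
qed

lemma finite_order_eigenvector:
  assumes A: "A \<in> carrier_mat n n" and "k > 0" and Ak: "A ^\<^sub>m k = 1\<^sub>m n"
    and W: "lin_subspace n W" "\<And>x. x \<in> W \<Longrightarrow> A *\<^sub>v x \<in> W"
    and v: "v \<in> W" "v \<noteq> 0\<^sub>v n"
  shows "\<exists>w\<in>W. w \<noteq> 0\<^sub>v n \<and> (\<exists>c. A *\<^sub>v w = c \<cdot>\<^sub>v w)"
proof -
  have vc: "v \<in> carrier_vec n" using v W unfolding lin_subspace_iff by auto
  note c = poly_apply_carrier[OF A vc]
  have monom: "poly_apply A (Polynomial.monom 1 j) v = A ^\<^sub>m j *\<^sub>v v" for j
  proof (induction j)
    case 0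
    have "A *\<^sub>v 0\<^sub>v n = 0\<^sub>v n" using A by auto
    then show ?case using A vc poly_apply_pCons[OF A vc, of 1 0] poly_apply_0[OF vc, of A]
      by (simp add: monom_0)
  next
    case (Suc j)
    have "A * A ^\<^sub>m j = A ^\<^sub>m j * A"
      by (induction j) (use A in \<open>auto simp: assoc_mult_mat[of _ n n _ n _ n, symmetric]\<close>)
    hence "A *\<^sub>v (A ^\<^sub>m j *\<^sub>v v) = (A ^\<^sub>m j * A) *\<^sub>v v"
      using A vc assoc_mult_mat_vec[of A n n "A ^\<^sub>m j" n v] by simp
    thus ?case using Suc poly_apply_pCons[OF A vc, of 0 "Polynomial.monom 1 j"] A vc
      by (auto simp: monom_Suc)
  qed
  obtain j where j: "k = Suc j" using \<open>k > 0\<close> by (cases k) auto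
  let ?p = "pCons (-1) (Polynomial.monom 1 j) :: complex poly"
  have "poly_apply A (Polynomial.monom 1 k) v = A *\<^sub>v poly_apply A (Polynomial.monom 1 j) v"
    using poly_apply_pCons[OF A vc, of 0 "Polynomial.monom 1 j"] A vc c by (auto simp: j monom_Suc)
  hence "A *\<^sub>v poly_apply A (Polynomial.monom 1 j) v = v" using monom[of k] Ak vc by simp
  hence "poly_apply A ?p v = 0\<^sub>v n"
    using poly_apply_pCons[OF A vc, of "-1" "Polynomial.monom 1 j"] vc by auto
  thus ?thesis using eigenvector_if_poly_kills[OF A W v, of ?p] by simp
qed

text \<open>
  The eigenspace in \<open>W\<close> of one operator is invariant under the operators that commute with it.
\<close>
lemma common_eigenvector:
  assumes "finite F" "lin_subspace n W" "\<exists>v\<in>W. v \<noteq> 0\<^sub>v n"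
    and F: "\<And>A. A \<in> F \<Longrightarrow> A \<in> carrier_mat n n" "\<And>A. A \<in> F \<Longrightarrow> \<exists>k>0. A ^\<^sub>m k = 1\<^sub>m n"
      "\<And>A x. A \<in> F \<Longrightarrow> x \<in> W \<Longrightarrow> A *\<^sub>v x \<in> W"
    and comm: "\<And>A A' x. A \<in> F \<Longrightarrow> A' \<in> F \<Longrightarrow> x \<in> W \<Longrightarrow> A *\<^sub>v (A' *\<^sub>v x) = A' *\<^sub>v (A *\<^sub>v x)"
  shows "\<exists>v\<in>W. v \<noteq> 0\<^sub>v n \<and> (\<forall>A\<in>F. \<exists>c. A *\<^sub>v v = c \<cdot>\<^sub>v v)"
  using assms
proof (induction F arbitrary: W rule: finite_induct)
  case empty
  then show ?case by auto
next
  case (insert A F)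
  obtain v where v: "v \<in> W" "v \<noteq> 0\<^sub>v n" using insert.prems by auto
  have A: "A \<in> carrier_mat n n" using insert.prems by auto
  obtain k where k: "k > 0" "A ^\<^sub>m k = 1\<^sub>m n" using insert.prems by blast
  obtain w c where w: "w \<in> W" "w \<noteq> 0\<^sub>v n" "A *\<^sub>v w = c \<cdot>\<^sub>v w"
    using finite_order_eigenvector[OF A k insert.prems(1) _ v] insert.prems(5) by blast
  define E where "E = {x \<in> W. A *\<^sub>v x = c \<cdot>\<^sub>v x}"
  have WC: "W \<subseteq> carrier_vec n" using insert.prems(1) unfolding lin_subspace_iff by auto
  have smA: "A *\<^sub>v (d \<cdot>\<^sub>v x) = d \<cdot>\<^sub>v (A *\<^sub>v x)" if "x \<in> W" for d x
    using mult_mat_vec[OF A] that WC by auto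
  have addA: "A *\<^sub>v (x + y) = A *\<^sub>v x + A *\<^sub>v y" if "x \<in> W" "y \<in> W" for x y
    using mult_add_distrib_mat_vec[OF A, of x y] that WC by auto
  have E: "lin_subspace n E"
    using insert.prems(1) A smA addA unfolding lin_subspace_iff E_def
    by (auto simp: smult_smult_assoc mult.commute smult_add_distrib_vec[of _ n] subset_iff)
  have "\<exists>v\<in>E. v \<noteq> 0\<^sub>v n \<and> (\<forall>A\<in>F. \<exists>c. A *\<^sub>v v = c \<cdot>\<^sub>v v)"
  proof (rule insert.IH[OF E])
    show "\<exists>v\<in>E. v \<noteq> 0\<^sub>v n" using w unfolding E_def by auto
    fix A' x assume A': "A' \<in> F" and x: "x \<in> E"
    have "A *\<^sub>v (A' *\<^sub>v x) = A' *\<^sub>v (c \<cdot>\<^sub>v x)"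
      using insert.prems(6)[of A A' x] A' x unfolding E_def by simp
    also have "\<dots> = c \<cdot>\<^sub>v (A' *\<^sub>v x)"
      using mult_mat_vec[of A' n n x c] A' x WC insert.prems(3)[of A'] unfolding E_def by auto
    finally show "A' *\<^sub>v x \<in> E" using insert.prems(5)[of A' x] A' x unfolding E_def by auto
  next
    fix A' A'' x assume "A' \<in> F" "A'' \<in> F" "x \<in> E"
    thus "A' *\<^sub>v (A'' *\<^sub>v x) = A'' *\<^sub>v (A' *\<^sub>v x)"
      using insert.prems(6)[of A' A'' x] unfolding E_def by auto
  qed (use insert.prems in auto)
  thus ?case unfolding E_def by auto
qed

section \<open>Complex representations of a finite group\<close>

lemma complex_rep_carrier: "complex_rep G d R \<Longrightarrow> g \<in> carrier G \<Longrightarrow> R g \<in> carrier_mat d d"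
  unfolding complex_rep_def hom_def units_of_def Units_def by (auto simp: ring_mat_simps)

lemma complex_rep_mult:
  "complex_rep G d R \<Longrightarrow> g \<in> carrier G \<Longrightarrow> h \<in> carrier G \<Longrightarrow> R (g \<otimes>\<^bsub>G\<^esub> h) = R g * R h"
  unfolding complex_rep_def hom_def units_of_def by (auto simp: ring_mat_simps)

lemma complex_rep_one:
  assumes "group G" "complex_rep G d R"
  shows "R \<one>\<^bsub>G\<^esub> = 1\<^sub>m d"
proof -
  interpret M: Ring.ring "ring_mat TYPE(complex) d ()" by (rule ring_mat)
  have "group (GL_complex d)" by (rule M.units_group)
  thus ?thesis using hom_one[of R G "GL_complex d"] assms
    unfolding complex_rep_def by (auto simp: units_of_def ring_mat_simps)
qed

lemma complex_rep_act:
  assumes "complex_rep G d R" "g \<in> carrier G" "h \<in> carrier G" "v \<in> carrier_vec d"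
  shows "R (g \<otimes>\<^bsub>G\<^esub> h) *\<^sub>v v = R g *\<^sub>v (R h *\<^sub>v v)"
  using assms complex_rep_carrier[OF assms(1)]
  by (simp add: complex_rep_mult assoc_mult_mat_vec[of _ d d _ d])

lemma complex_rep_finite_order:
  assumes G: "group G" "finite (carrier G)" and R: "complex_rep G d R" and g: "g \<in> carrier G"
  shows "\<exists>k>0. R g ^\<^sub>m k = 1\<^sub>m d"
proof -
  interpret group G by fact
  have "R (g [^]\<^bsub>G\<^esub> k) = R g ^\<^sub>m k" for k :: nat
  proof (induction k)
    case 0
    have "dim_row (R g) = d" using complex_rep_carrier[OF R g] by auto
    then show ?case using complex_rep_one[OF G(1) R] by simp
  qed (use g complex_rep_mult[OF R] in auto)
  from this[of "Coset.order G"] have "R g ^\<^sub>m Coset.order G = 1\<^sub>m d"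
    using pow_order_eq_1[OF g] complex_rep_one[OF G(1) R] by simp
  moreover have "Coset.order G > 0" using order_gt_0_iff_finite G by simp
  ultimately show ?thesis by blast
qed

lemma complex_repI:
  assumes "group G" "R \<one>\<^bsub>G\<^esub> = 1\<^sub>m d" "\<And>g. g \<in> carrier G \<Longrightarrow> R g \<in> carrier_mat d d"
    and mult: "\<And>g h. g \<in> carrier G \<Longrightarrow> h \<in> carrier G \<Longrightarrow> R (g \<otimes>\<^bsub>G\<^esub> h) = R g * R h"
  shows "complex_rep G d R"
proof -
  interpret group G by fact
  have "\<exists>B\<in>carrier_mat d d. B * R g = 1\<^sub>m d \<and> R g * B = 1\<^sub>m d" if "g \<in> carrier G" for g
    using mult[of g "inv\<^bsub>G\<^esub> g"] mult[of "inv\<^bsub>G\<^esub> g" g] assms that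
    by (intro bexI[of _ "R (inv\<^bsub>G\<^esub> g)"]) auto
  thus ?thesis using assms
    unfolding complex_rep_def hom_def units_of_def Units_def by (auto simp: ring_mat_simps)
qed

lemma mem_cd_iff:
  assumes "group G"
  shows "d \<in> cd G \<longleftrightarrow> (\<exists>R. irreducible_rep G d R)"
proof -
  interpret group G by fact
  have "mat_trace (R \<one>\<^bsub>G\<^esub>) = of_nat n" if "irreducible_rep G n R" for n R
    using that complex_rep_one[OF assms, of n R] unfolding irreducible_rep_def by (simp add: mat_trace_def)
  thus ?thesis unfolding cd_def Irr_def character_of_def by fastforce
qed

text \<open>
  The span of the \<open>w i\<close> is invariant, hence everything; distinct weights make the \<open>w i\<close> linearly
  independent, by separating their components in the zero subspace.
\<close>
lemma irreducible_degree_eq_card: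
  fixes w :: "'i \<Rightarrow> complex vec"
  assumes irr: "irreducible_rep G d R" and I: "finite I" "I \<noteq> {}"
    and w: "\<And>i. i \<in> I \<Longrightarrow> w i \<in> carrier_vec d" "\<And>i. i \<in> I \<Longrightarrow> w i \<noteq> 0\<^sub>v d"
    and perm: "\<And>g i. g \<in> carrier G \<Longrightarrow> i \<in> I \<Longrightarrow> \<exists>j\<in>I. \<exists>c. R g *\<^sub>v w i = c \<cdot>\<^sub>v w j"
    and B: "\<And>b. b \<in> B \<Longrightarrow> \<beta> b \<in> carrier G" "\<And>b i. b \<in> B \<Longrightarrow> i \<in> I \<Longrightarrow> R (\<beta> b) *\<^sub>v w i = l b i \<cdot>\<^sub>v w i"
    and sep: "\<And>i j. i \<in> I \<Longrightarrow> j \<in> I \<Longrightarrow> i \<noteq> j \<Longrightarrow> \<exists>b\<in>B. l b i \<noteq> l b j"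
  shows "d = card I"
proof -
  interpret V: vec_space "TYPE(complex)" d .
  have R: "complex_rep G d R" using irr unfolding irreducible_rep_def by auto
  note Rc = complex_rep_carrier[OF R]
  have dimw: "dim_vec (w i) = d" if "i \<in> I" for i using w(1)[OF that] by auto
  have inj: "inj_on w I"
  proof (rule inj_onI, rule ccontr)
    fix i j assume ij: "i \<in> I" "j \<in> I" "w i = w j" "i \<noteq> j"
    then obtain b where b: "b \<in> B" "l b i \<noteq> l b j" using sep by blast
    have "l b i \<cdot>\<^sub>v w i = l b j \<cdot>\<^sub>v w i" using B(2)[OF b(1)] ij by metis
    thus False using smult_vec_cancel w b ij by blast
  qed
  let ?A = "w ` I"
  have Ac: "?A \<subseteq> carrier_vec d" using w by auto
  have indep: "V.lin_indpt ?A"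
  proof (rule V.finite_lin_indpt2)
    fix a assume "V.lincomb a ?A = 0\<^sub>v d"
    hence sum0: "(\<Sum>x\<in>?A. a x * x $ k) = 0" if "k < d" for k
      using V.lincomb_index[OF that Ac, of a] that by simp
    have zero: "\<forall>i\<in>I. a (w i) \<cdot>\<^sub>v w i \<in> {0\<^sub>v d}"
    proof (rule weight_components_in_subspace[where v = "0\<^sub>v d" and B = B and M = "\<lambda>b. R (\<beta> b)" and l = l, OF I(1)])
      show "lin_subspace d {0\<^sub>v d}" unfolding lin_subspace_iff by auto
      show "0\<^sub>v d $ k = (\<Sum>i\<in>I. (a (w i) \<cdot>\<^sub>v w i) $ k)" if "k < d" for k
        using sum0[OF that] that dimw by (subst (asm) sum.reindex[OF inj]) simp
      show "R (\<beta> b) *\<^sub>v x \<in> {0\<^sub>v d}" if "b \<in> B" "x \<in> {0\<^sub>v d}" for b x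
      proof -
        have "R (\<beta> b) \<in> carrier_mat d d" using that Rc B by auto
        thus ?thesis using that by auto
      qed
      show "R (\<beta> b) *\<^sub>v (a (w i) \<cdot>\<^sub>v w i) = l b i \<cdot>\<^sub>v (a (w i) \<cdot>\<^sub>v w i)" if "b \<in> B" "i \<in> I" for b i
      proof -
        have "R (\<beta> b) *\<^sub>v (a (w i) \<cdot>\<^sub>v w i) = a (w i) \<cdot>\<^sub>v (l b i \<cdot>\<^sub>v w i)"
          using mult_mat_vec[of "R (\<beta> b)" d d "w i"] Rc B w that by auto
        thus ?thesis by (simp add: smult_smult_assoc mult.commute)
      qed
    qed (use w Rc B sep in auto)
    hence "a (w i) = 0" if "i \<in> I" for i
    proof -
      have "0 \<cdot>\<^sub>v w i = 0\<^sub>v d" using dimw[OF that] by (intro eq_vecI) auto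
      hence "a (w i) \<cdot>\<^sub>v w i = 0 \<cdot>\<^sub>v w i" using zero that by simp
      thus ?thesis using smult_vec_cancel w that by blast
    qed
    thus "\<forall>v\<in>?A. a v = 0" by auto
  qed (use I Ac in auto)
  have sub: "lin_subspace d (V.span ?A)"
    using V.span_is_subspace[OF Ac] by simp
  have AS: "?A \<subseteq> V.span ?A" using V.in_own_span[OF Ac] by simp
  have "R g *\<^sub>v x \<in> V.span ?A" if g: "g \<in> carrier G" and x: "x \<in> V.span ?A" for g x
  proof -
    let ?X = "{x \<in> carrier_vec d. R g *\<^sub>v x \<in> V.span ?A}"
    have "R g *\<^sub>v 0\<^sub>v d = 0\<^sub>v d" using Rc[OF g] by auto
    hence X: "lin_subspace d ?X"
      using sub Rc[OF g] mult_mat_vec[OF Rc[OF g]] mult_add_distrib_mat_vec[OF Rc[OF g]]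
      unfolding lin_subspace_iff by auto
    have "?A \<subseteq> ?X"
    proof safe
      fix i assume i: "i \<in> I"
      then obtain j c where j: "j \<in> I" "R g *\<^sub>v w i = c \<cdot>\<^sub>v w j" using perm g by blast
      thus "R g *\<^sub>v w i \<in> V.span ?A" using AS sub unfolding lin_subspace_iff by auto
    qed (use w in auto)
    hence "V.span ?A \<subseteq> ?X" using V.span_is_subset[of ?A ?X] X by auto
    thus ?thesis using x by auto
  qed
  hence "V.span ?A = {0\<^sub>v d} \<or> V.span ?A = carrier_vec d"
    using irr sub unfolding irreducible_rep_def by blast
  hence "V.span ?A = carrier_vec d" using AS w I by blast
  hence "V.basis ?A" unfolding V.basis_def using indep Ac by auto
  hence "V.dim = card ?A" using V.dim_basis[of ?A] I by auto
  thus ?thesis using V.dim_is_n inj by (simp add: card_image)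
qed

text \<open>
  Let \<open>T\<close> act on \<open>v\<close> by scalars and let \<open>r\<close> run through representatives of the cosets \<open>T r\<close>. The vectors
  \<open>r\<inverse> v\<close> span lines that \<open>G\<close> permutes, and an element \<open>b\<close> acts on \<open>r\<inverse> v\<close> as its conjugate \<open>r b r\<inverse>\<close> acts on \<open>v\<close>.
  If the elements \<open>\<beta> b\<close> tell these lines apart, the dimension is therefore the number of representatives. The conjugate
  is given by an element \<open>h\<close> with \<open>r b = h r\<close>, which avoids computing inverses in applications.
\<close>
lemma irreducible_degree_eq_transversal:
  assumes G: "group G" and irr: "irreducible_rep G d R" and I: "finite I" "I \<noteq> {}"
    and v: "v \<in> carrier_vec d" "v \<noteq> 0\<^sub>v d"
    and T: "T \<subseteq> carrier G" "\<And>t. t \<in> T \<Longrightarrow> \<exists>c. R t *\<^sub>v v = c \<cdot>\<^sub>v v"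
    and r: "\<And>i. i \<in> I \<Longrightarrow> r i \<in> carrier G"
    and cover: "\<And>g. g \<in> carrier G \<Longrightarrow> \<exists>i\<in>I. \<exists>t\<in>T. g = t \<otimes>\<^bsub>G\<^esub> r i"
    and B: "\<And>b. b \<in> B \<Longrightarrow> \<beta> b \<in> carrier G"
    and conj: "\<And>b i. b \<in> B \<Longrightarrow> i \<in> I \<Longrightarrow>
      \<exists>h\<in>carrier G. r i \<otimes>\<^bsub>G\<^esub> \<beta> b = h \<otimes>\<^bsub>G\<^esub> r i \<and> R h *\<^sub>v v = l b i \<cdot>\<^sub>v v"
    and sep: "\<And>i j. i \<in> I \<Longrightarrow> j \<in> I \<Longrightarrow> i \<noteq> j \<Longrightarrow> \<exists>b\<in>B. l b i \<noteq> l b j"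
  shows "d = card I"
proof -
  interpret group G by fact
  have R: "complex_rep G d R" using irr unfolding irreducible_rep_def by auto
  note Rc = complex_rep_carrier[OF R]
  define w where "w = (\<lambda>i. R (inv\<^bsub>G\<^esub> (r i)) *\<^sub>v v)"
  have unit: "R t *\<^sub>v (R (inv\<^bsub>G\<^esub> t) *\<^sub>v x) = x" if "t \<in> carrier G" "x \<in> carrier_vec d" for t x
    using complex_rep_act[OF R, of t "inv\<^bsub>G\<^esub> t" x] complex_rep_one[OF G R] that by simp
  obtain \<chi> where \<chi>: "\<And>t. t \<in> T \<Longrightarrow> R t *\<^sub>v v = \<chi> t \<cdot>\<^sub>v v" using T(2) by metis
  have tinv: "R (inv\<^bsub>G\<^esub> t) *\<^sub>v v = inverse (\<chi> t) \<cdot>\<^sub>v v" if t: "t \<in> T" for t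
  proof -
    have tc: "t \<in> carrier G" using t T by auto
    have 1: "v = \<chi> t \<cdot>\<^sub>v (R (inv\<^bsub>G\<^esub> t) *\<^sub>v v)"
    proof -
      have "v = R (inv\<^bsub>G\<^esub> t) *\<^sub>v (R t *\<^sub>v v)" using unit[of "inv\<^bsub>G\<^esub> t" v] tc v by simp
      also have "\<dots> = \<chi> t \<cdot>\<^sub>v (R (inv\<^bsub>G\<^esub> t) *\<^sub>v v)"
        unfolding \<chi>[OF t] using mult_mat_vec[OF Rc[of "inv\<^bsub>G\<^esub> t"] v(1)] tc by simp
      finally show ?thesis .
    qed
    have "R (inv\<^bsub>G\<^esub> t) *\<^sub>v v \<in> carrier_vec d" using Rc[of "inv\<^bsub>G\<^esub> t"] tc v by auto
    moreover have "0 \<cdot>\<^sub>v x = 0\<^sub>v d" if "x \<in> carrier_vec d" for x :: "complex vec"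
      using that by (intro eq_vecI) auto
    ultimately have "\<chi> t \<noteq> 0" using 1 v by metis
    have "inverse (\<chi> t) \<cdot>\<^sub>v v = inverse (\<chi> t) \<cdot>\<^sub>v (\<chi> t \<cdot>\<^sub>v (R (inv\<^bsub>G\<^esub> t) *\<^sub>v v))"
      using 1 by simp
    thus ?thesis using \<open>\<chi> t \<noteq> 0\<close> by (simp add: smult_smult_assoc)
  qed
  show ?thesis
  proof (rule irreducible_degree_eq_card[OF irr I, where w = w and B = B and \<beta> = \<beta> and l = l])
    fix i assume i: "i \<in> I"
    have ri: "inv\<^bsub>G\<^esub> (r i) \<in> carrier G" "r i \<in> carrier G" using r[OF i] by auto
    show "w i \<in> carrier_vec d" unfolding w_def using Rc[OF ri(1)] v by auto
    show "w i \<noteq> 0\<^sub>v d"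
    proof
      assume "w i = 0\<^sub>v d"
      moreover have "R (r i) *\<^sub>v w i = v" unfolding w_def using unit ri v by auto
      ultimately show False using v Rc[OF ri(2)] by auto
    qed
    fix g assume g: "g \<in> carrier G"
    have "r i \<otimes>\<^bsub>G\<^esub> inv\<^bsub>G\<^esub> g \<in> carrier G" using g ri by auto
    then obtain j t where j: "j \<in> I" "t \<in> T" "r i \<otimes>\<^bsub>G\<^esub> inv\<^bsub>G\<^esub> g = t \<otimes>\<^bsub>G\<^esub> r j"
      using cover by blast
    have tj: "t \<in> carrier G" "r j \<in> carrier G" using j T r by auto
    have "g \<otimes>\<^bsub>G\<^esub> inv\<^bsub>G\<^esub> (r i) = inv\<^bsub>G\<^esub> (r i \<otimes>\<^bsub>G\<^esub> inv\<^bsub>G\<^esub> g)"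
      using g ri by (simp add: inv_mult_group)
    also have "\<dots> = inv\<^bsub>G\<^esub> (r j) \<otimes>\<^bsub>G\<^esub> inv\<^bsub>G\<^esub> t" unfolding j(3) using tj by (simp add: inv_mult_group)
    finally have eq: "g \<otimes>\<^bsub>G\<^esub> inv\<^bsub>G\<^esub> (r i) = inv\<^bsub>G\<^esub> (r j) \<otimes>\<^bsub>G\<^esub> inv\<^bsub>G\<^esub> t" .
    have "R g *\<^sub>v w i = R (g \<otimes>\<^bsub>G\<^esub> inv\<^bsub>G\<^esub> (r i)) *\<^sub>v v"
      unfolding w_def using complex_rep_act[OF R g ri(1) v(1)] by simp
    also have "\<dots> = R (inv\<^bsub>G\<^esub> (r j)) *\<^sub>v (R (inv\<^bsub>G\<^esub> t) *\<^sub>v v)"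
      unfolding eq using complex_rep_act[OF R _ _ v(1)] tj by simp
    also have "\<dots> = inverse (\<chi> t) \<cdot>\<^sub>v w j"
      unfolding w_def tinv[OF j(2)] using mult_mat_vec[OF Rc[of "inv\<^bsub>G\<^esub> (r j)"] v(1)] tj by simp
    finally show "\<exists>j\<in>I. \<exists>c. R g *\<^sub>v w i = c \<cdot>\<^sub>v w j" using j(1) by blast
  next
    fix b i assume b: "b \<in> B" and i: "i \<in> I"
    have ri: "inv\<^bsub>G\<^esub> (r i) \<in> carrier G" "r i \<in> carrier G" using r[OF i] by auto
    have bc: "\<beta> b \<in> carrier G" using b B by auto
    obtain h where h: "h \<in> carrier G" "r i \<otimes>\<^bsub>G\<^esub> \<beta> b = h \<otimes>\<^bsub>G\<^esub> r i" "R h *\<^sub>v v = l b i \<cdot>\<^sub>v v"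
      using conj[OF b i] by auto
    have "\<beta> b \<otimes>\<^bsub>G\<^esub> inv\<^bsub>G\<^esub> (r i) = inv\<^bsub>G\<^esub> (r i) \<otimes>\<^bsub>G\<^esub> (r i \<otimes>\<^bsub>G\<^esub> \<beta> b) \<otimes>\<^bsub>G\<^esub> inv\<^bsub>G\<^esub> (r i)"
      using bc ri by (simp add: m_assoc inv_solve_left)
    also have "\<dots> = inv\<^bsub>G\<^esub> (r i) \<otimes>\<^bsub>G\<^esub> h" unfolding h(2) using ri h by (simp add: m_assoc)
    finally have eq: "\<beta> b \<otimes>\<^bsub>G\<^esub> inv\<^bsub>G\<^esub> (r i) = inv\<^bsub>G\<^esub> (r i) \<otimes>\<^bsub>G\<^esub> h" .
    have "R (\<beta> b) *\<^sub>v w i = R (inv\<^bsub>G\<^esub> (r i) \<otimes>\<^bsub>G\<^esub> h) *\<^sub>v v"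
      unfolding w_def eq[symmetric] using complex_rep_act[OF R bc ri(1) v(1)] by simp
    also have "\<dots> = R (inv\<^bsub>G\<^esub> (r i)) *\<^sub>v (l b i \<cdot>\<^sub>v v)"
      using complex_rep_act[OF R ri(1) h(1) v(1)] h(3) by simp
    also have "\<dots> = l b i \<cdot>\<^sub>v w i"
      unfolding w_def using mult_mat_vec[OF Rc[OF ri(1)] v(1)] by simp
    finally show "R (\<beta> b) *\<^sub>v w i = l b i \<cdot>\<^sub>v w i" .
  qed (use B sep in auto)
qed

text \<open>
  The group acts on functions on \<open>X\<close> by \<open>(g f)(s) = c g s * f (\<pi> g s)\<close>; the conditions on \<open>c\<close> and \<open>\<pi>\<close> say that
  this is an action. The elements of \<open>B\<close> act diagonally with pairwise distinct weights, so an invariant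
  subspace that contains a nonzero function contains the indicator of a point, and by transitivity the
  indicators of all points.
\<close>
lemma monomial_rep_irreducible:
  fixes X :: "'s set" and \<pi> :: "'a \<Rightarrow> 's \<Rightarrow> 's" and c :: "'a \<Rightarrow> 's \<Rightarrow> complex"
  assumes G: "group G" and X: "finite X" "X \<noteq> {}"
    and cl: "\<And>g s. g \<in> carrier G \<Longrightarrow> s \<in> X \<Longrightarrow> \<pi> g s \<in> X"
    and one: "\<And>s. s \<in> X \<Longrightarrow> \<pi> \<one>\<^bsub>G\<^esub> s = s" "\<And>s. s \<in> X \<Longrightarrow> c \<one>\<^bsub>G\<^esub> s = 1"
    and mult: "\<And>g h s. g \<in> carrier G \<Longrightarrow> h \<in> carrier G \<Longrightarrow> s \<in> X \<Longrightarrow> \<pi> (g \<otimes>\<^bsub>G\<^esub> h) s = \<pi> h (\<pi> g s)"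
      "\<And>g h s. g \<in> carrier G \<Longrightarrow> h \<in> carrier G \<Longrightarrow> s \<in> X \<Longrightarrow> c (g \<otimes>\<^bsub>G\<^esub> h) s = c g s * c h (\<pi> g s)"
    and trans: "\<And>s s'. s \<in> X \<Longrightarrow> s' \<in> X \<Longrightarrow> \<exists>g\<in>carrier G. \<pi> g s = s'"
    and B: "B \<subseteq> carrier G" "\<And>b s. b \<in> B \<Longrightarrow> s \<in> X \<Longrightarrow> \<pi> b s = s"
    and sep: "\<And>s s'. s \<in> X \<Longrightarrow> s' \<in> X \<Longrightarrow> s \<noteq> s' \<Longrightarrow> \<exists>b\<in>B. c b s \<noteq> c b s'"
  shows "\<exists>R. irreducible_rep G (card X) R"
proof -
  interpret group G by fact
  let ?d = "card X"
  obtain h where h: "bij_betw h {..<?d} X"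
    using ex_bij_betw_nat_finite[OF X(1)] by (auto simp: lessThan_atLeast0)
  have hO: "h i \<in> X" if "i < ?d" for i using h that by (auto simp: bij_betw_def)
  have hinj: "h i = h j \<longleftrightarrow> i = j" if "i < ?d" "j < ?d" for i j
    using h that unfolding bij_betw_def inj_on_def by auto
  have hsurj: "\<exists>i<?d. h i = s" if "s \<in> X" for s
    using h that unfolding bij_betw_def by (metis imageE lessThan_iff)
  define R where "R = (\<lambda>g. mat ?d ?d (\<lambda>(i, j). if h j = \<pi> g (h i) then c g (h i) else 0))"
  have Rc: "R g \<in> carrier_mat ?d ?d" for g by (simp add: R_def)
  have R: "complex_rep G ?d R"
  proof (rule complex_repI[OF G])
    show "R \<one>\<^bsub>G\<^esub> = 1\<^sub>m ?d"
      by (rule eq_matI) (auto simp: R_def one hO hinj)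
    fix g k assume g: "g \<in> carrier G" "k \<in> carrier G"
    show "R (g \<otimes>\<^bsub>G\<^esub> k) = R g * R k"
    proof (rule eq_matI)
      fix i j assume "i < dim_row (R g * R k)" "j < dim_col (R g * R k)"
      hence ij: "i < ?d" "j < ?d" by (auto simp: R_def)
      obtain m where m: "m < ?d" "h m = \<pi> g (h i)" using hsurj cl[OF g(1) hO[OF ij(1)]] by blast
      have "(R g * R k) $$ (i, j) = (\<Sum>l = 0..<?d. R g $$ (i, l) * R k $$ (l, j))"
        using ij by (auto simp: R_def times_mat_def scalar_prod_def)
      also have "\<dots> = (\<Sum>l = 0..<?d. if l = m then c g (h i) * R k $$ (m, j) else 0)"
        using ij m(1) by (intro sum.cong) (auto simp: R_def hinj m(2)[symmetric])
      also have "\<dots> = c g (h i) * R k $$ (m, j)" using m by (simp add: sum.delta)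
      also have "\<dots> = R (g \<otimes>\<^bsub>G\<^esub> k) $$ (i, j)"
        using ij m g hO by (auto simp: R_def mult)
      finally show "R (g \<otimes>\<^bsub>G\<^esub> k) $$ (i, j) = (R g * R k) $$ (i, j)" by simp
    qed (auto simp: R_def)
  qed (use Rc in auto)
  have Rv: "(R g *\<^sub>v v) $ i = c g (h i) * v $ j"
    if "g \<in> carrier G" "v \<in> carrier_vec ?d" "i < ?d" "j < ?d" "h j = \<pi> g (h i)" for g v i j
  proof -
    have "(R g *\<^sub>v v) $ i = (\<Sum>m<?d. R g $$ (i, m) * v $ m)"
      using mult_mat_vec_index_sum[OF Rc that(2,3)] .
    also have "\<dots> = (\<Sum>m<?d. if m = j then c g (h i) * v $ j else 0)"
      using that(1-4) by (intro sum.cong) (auto simp: R_def hinj that(5)[symmetric])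
    finally show ?thesis using that by simp
  qed
  have cnz: "c g s \<noteq> 0" if "g \<in> carrier G" "s \<in> X" for g s
    using mult(2)[of g "inv\<^bsub>G\<^esub> g" s] one that by auto
  have "W = {0\<^sub>v ?d} \<or> W = carrier_vec ?d"
    if W: "lin_subspace ?d W" and inv: "\<forall>g\<in>carrier G. \<forall>w\<in>W. R g *\<^sub>v w \<in> W" for W
  proof (cases "W = {0\<^sub>v ?d}")
    case False
    have Wc: "W \<subseteq> carrier_vec ?d" and Wz: "0\<^sub>v ?d \<in> W" and Wadd: "\<And>x y. x \<in> W \<Longrightarrow> y \<in> W \<Longrightarrow> x + y \<in> W"
      and Wsm: "\<And>a x. x \<in> W \<Longrightarrow> a \<cdot>\<^sub>v x \<in> W" using W unfolding lin_subspace_iff by auto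
    obtain v where v: "v \<in> W" "v \<noteq> 0\<^sub>v ?d" using False Wz by auto
    have vc: "v \<in> carrier_vec ?d" using v Wc by auto
    have unitB: "R b *\<^sub>v (a \<cdot>\<^sub>v unit_vec ?d i) = c b (h i) \<cdot>\<^sub>v (a \<cdot>\<^sub>v unit_vec ?d i)"
      if "b \<in> B" "i < ?d" for a b i
    proof (rule eq_vecI)
      fix k assume k: "k < dim_vec (c b (h i) \<cdot>\<^sub>v (a \<cdot>\<^sub>v unit_vec ?d i))"
      hence "(R b *\<^sub>v (a \<cdot>\<^sub>v unit_vec ?d i)) $ k = c b (h k) * (a \<cdot>\<^sub>v unit_vec ?d i) $ k"
        using B that hO by (intro Rv) auto
      thus "(R b *\<^sub>v (a \<cdot>\<^sub>v unit_vec ?d i)) $ k = (c b (h i) \<cdot>\<^sub>v (a \<cdot>\<^sub>v unit_vec ?d i)) $ k"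
        using k that by auto
    qed (use Rc in auto)
    have comp: "\<forall>i\<in>{..<?d}. v $ i \<cdot>\<^sub>v unit_vec ?d i \<in> W"
    proof (rule weight_components_in_subspace[where v = v and B = B and M = R and l = "\<lambda>b i. c b (h i)"])
      show "v $ k = (\<Sum>i<?d. (v $ i \<cdot>\<^sub>v unit_vec ?d i) $ k)" if "k < ?d" for k
        using that by (simp add: if_distrib cong: if_cong)
    qed (use W v Rc B inv unitB sep hO hinj in \<open>auto simp: subset_iff\<close>)
    obtain i where i: "i < ?d" "v $ i \<noteq> 0"
    proof (rule ccontr)
      assume "\<not> thesis"
      hence "v = 0\<^sub>v ?d" using vc that by (intro eq_vecI) auto
      thus False using v by auto
    qed
    have "inverse (v $ i) \<cdot>\<^sub>v (v $ i \<cdot>\<^sub>v unit_vec ?d i) \<in> W" using comp i Wsm by auto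
    hence ui: "unit_vec ?d i \<in> W" using i by (simp add: smult_smult_assoc)
    have uj: "unit_vec ?d j \<in> W" if j: "j < ?d" for j
    proof -
      obtain g where g: "g \<in> carrier G" "\<pi> g (h j) = h i" using trans hO i j by blast
      have "R g *\<^sub>v unit_vec ?d i = c g (h j) \<cdot>\<^sub>v unit_vec ?d j"
      proof (rule eq_vecI)
        fix k assume "k < dim_vec (c g (h j) \<cdot>\<^sub>v unit_vec ?d j)"
        hence k: "k < ?d" by simp
        obtain m where m: "m < ?d" "h m = \<pi> g (h k)" using hsurj cl[OF g(1) hO[OF k]] by blast
        have "m = i \<longleftrightarrow> k = j"
        proof
          assume "m = i"
          hence "\<pi> (inv\<^bsub>G\<^esub> g) (\<pi> g (h k)) = \<pi> (inv\<^bsub>G\<^esub> g) (\<pi> g (h j))" using m g by simp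
          moreover have "\<pi> (inv\<^bsub>G\<^esub> g) (\<pi> g s) = s" if "s \<in> X" for s
            using mult(1)[of g "inv\<^bsub>G\<^esub> g" s] one that g by simp
          ultimately have "h k = h j" using hO k j by simp
          thus "k = j" using hinj k j by simp
        next
          assume "k = j"
          thus "m = i" using m g hinj i by simp
        qed
        thus "(R g *\<^sub>v unit_vec ?d i) $ k = (c g (h j) \<cdot>\<^sub>v unit_vec ?d j) $ k"
          using Rv[OF g(1) _ k m, of "unit_vec ?d i"] m k i j by auto
      qed (use Rc in auto)
      hence "c g (h j) \<cdot>\<^sub>v unit_vec ?d j \<in> W" using inv g ui by metis
      hence "inverse (c g (h j)) \<cdot>\<^sub>v (c g (h j) \<cdot>\<^sub>v unit_vec ?d j) \<in> W" using Wsm by blast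
      thus ?thesis using cnz[OF g(1) hO[OF j]] by (simp add: smult_smult_assoc)
    qed
    have "x \<in> W" if x: "x \<in> carrier_vec ?d" for x
    proof -
      have "m \<le> ?d \<Longrightarrow> vec ?d (\<lambda>k. if k < m then x $ k else 0) \<in> W" for m
      proof (induction m)
        case 0
        have "vec ?d (\<lambda>k. if k < 0 then x $ k else 0) = 0\<^sub>v ?d" by auto
        then show ?case using Wz by simp
      next
        case (Suc m)
        have "vec ?d (\<lambda>k. if k < Suc m then x $ k else 0)
            = vec ?d (\<lambda>k. if k < m then x $ k else 0) + x $ m \<cdot>\<^sub>v unit_vec ?d m"
          using Suc by (intro eq_vecI) (auto simp: less_Suc_eq)
        then show ?case using Suc uj[of m] Wadd Wsm by auto
      qed
      from this[of ?d] have "vec ?d (\<lambda>k. if k < ?d then x $ k else 0) \<in> W" by simp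
      moreover have "vec ?d (\<lambda>k. if k < ?d then x $ k else 0) = x" using x by (intro eq_vecI) auto
      ultimately show ?thesis by simp
    qed
    thus ?thesis using Wc by auto
  qed auto
  moreover have "?d > 0" using X by (simp add: card_gt_0_iff)
  ultimately show ?thesis using R unfolding irreducible_rep_def by blast
qed

section \<open>The Heisenberg group modulo \<open>N\<close>, extended by powers of a unit\<close>

text \<open>
  The quadruple \<open>(a, x, y, z)\<close> stands for the matrix with rows \<open>(1, y, z)\<close>, \<open>(0, a, x)\<close>, \<open>(0, 0, 1)\<close> over the
  integers modulo \<open>N\<close>. Reducing the entries in a constructor makes every identity between group elements
  an identity between integers modulo \<open>N\<close>.
\<close>
definition heis_elem :: "int \<Rightarrow> int \<Rightarrow> int \<Rightarrow> int \<Rightarrow> int \<Rightarrow> int \<times> int \<times> int \<times> int" where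
  "heis_elem N a x y z = (a mod N, x mod N, y mod N, z mod N)"

text \<open>
  Multiplication of these matrices, with \<open>a\<close> restricted to powers of \<open>u\<close>. The elements
  \<open>(1, 0, 0, z)\<close> are central, and a power \<open>a\<close> of \<open>u\<close> acts on \<open>x\<close> by \<open>a\<close> and on \<open>y\<close> by the inverse of \<open>a\<close>.
\<close>
definition heis :: "int \<Rightarrow> int \<Rightarrow> (int \<times> int \<times> int \<times> int) monoid" where
  "heis N u = \<lparr> carrier = {heis_elem N (u ^ j) x y z | j x y z. True},
     monoid.mult = (\<lambda>(a, x, y, z) (a', x', y', z'). heis_elem N (a * a') (x + a * x') (y' + y * a') (z + z' + y * x')),
     one = heis_elem N 1 0 0 0 \<rparr>"

definition root_char :: "int \<Rightarrow> int \<Rightarrow> complex" where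
  "root_char N k = cis (2 * pi * of_int k / of_int N)"

lemma root_char_add: "root_char N (k + l) = root_char N k * root_char N l"
  by (simp add: root_char_def cis_mult add_divide_distrib distrib_left)

lemma root_char_eq_1_iff:
  assumes "N > 0"
  shows "root_char N k = 1 \<longleftrightarrow> N dvd k"
proof
  assume "root_char N k = 1"
  hence "cos (2 * pi * of_int k / of_int N) = 1" by (auto simp: root_char_def complex_eq_iff)
  then obtain m :: int where "2 * pi * of_int k / of_int N = of_int m * (2 * pi)"
    using cos_one_2pi_int by auto
  hence "of_int k = of_int m * (of_int N :: real)" using assms by (simp add: field_simps)
  hence "of_int k = (of_int (m * N) :: real)" by simp
  hence "k = m * N" using of_int_eq_iff by blast
  thus "N dvd k" by simp
next
  assume "N dvd k"
  then obtain m where "k = N * m" by auto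
  hence "2 * pi * of_int k / of_int N = 2 * pi * of_int m" using assms by (simp add: field_simps)
  thus "root_char N k = 1" by (simp add: root_char_def)
qed

lemma root_char_nonzero [simp]: "root_char N k \<noteq> 0"
  by (simp add: root_char_def)

lemma root_char_eq_iff:
  assumes "N > 0"
  shows "root_char N k = root_char N l \<longleftrightarrow> [k = l] (mod N)"
proof -
  have "root_char N k = root_char N (k - l) * root_char N l" by (simp flip: root_char_add)
  hence "root_char N k = root_char N l \<longleftrightarrow> root_char N (k - l) = 1" by simp
  thus ?thesis using root_char_eq_1_iff[OF assms] by (simp add: cong_iff_dvd_diff)
qed

lemma root_char_surj:
  assumes "N > 0" "c ^ nat N = 1"
  shows "\<exists>s. c = root_char N s"
proof -
  have "c \<in> (\<lambda>k. cis (2 * pi * real k / real (nat N))) ` {..<nat N}"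
    using bij_betw_roots_unity[of "nat N"] assms unfolding bij_betw_def by auto
  then obtain k where "c = cis (2 * pi * real k / real (nat N))" by auto
  hence "c = root_char N (int k)" using assms by (simp add: root_char_def)
  thus ?thesis by blast
qed

lemma root_char_power: "root_char N s ^ k = root_char N (s * int k)"
  by (induction k) (simp_all add: root_char_add algebra_simps root_char_def[of N 0])

locale twisted_heis =
  fixes N u :: int and M :: nat
  assumes N: "N > 0" and M: "M > 0" and uM: "[u ^ M = 1] (mod N)"
begin

abbreviation "H \<equiv> heis N u"
abbreviation "e \<equiv> heis_elem N"
abbreviation "\<omega> \<equiv> root_char N"

lemma e_mult: "e a x y z \<otimes>\<^bsub>H\<^esub> e a' x' y' z' = e (a * a') (x + a * x') (y' + y * a') (z + z' + y * x')"
  by (auto simp: heis_def heis_elem_def simp flip: cong_def intro!: cong_add cong_mult)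

lemma e_eq_iff: "e a x y z = e a' x' y' z' \<longleftrightarrow>
    [a = a'] (mod N) \<and> [x = x'] (mod N) \<and> [y = y'] (mod N) \<and> [z = z'] (mod N)"
  by (auto simp: heis_elem_def cong_def)

lemma e_in [simp]: "e (u ^ j) x y z \<in> carrier H"
  by (auto simp: heis_def)

lemma e1_in [simp]: "e 1 x y z \<in> carrier H"
  using e_in[of 0] by simp

lemma in_carrierE: "g \<in> carrier H \<Longrightarrow> (\<And>j x y z. g = e (u ^ j) x y z \<Longrightarrow> P) \<Longrightarrow> P"
  by (auto simp: heis_def)

lemma one_eq: "\<one>\<^bsub>H\<^esub> = e 1 0 0 0"
  by (simp add: heis_def)

text \<open>The inverse of \<open>u\<close> modulo \<open>N\<close>, as a power of \<open>u\<close>, so that its powers occur as first coordinates.\<close>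
definition "ui \<equiv> u ^ (M - 1)"

lemma ui: "[ui ^ j * u ^ j = 1] (mod N)"
proof -
  have "ui * u = u ^ M" unfolding ui_def using M by (metis power_minus_mult)
  hence "ui ^ j * u ^ j = (u ^ M) ^ j" by (simp flip: power_mult_distrib)
  thus ?thesis using cong_pow[OF uM, of j] by simp
qed

lemma coprime_u: "coprime (u ^ j) N"
  using ui[of j] by (meson cong_imp_coprime cong_sym coprime_1_left coprime_mult_left_iff)

lemma group_heis: "group H"
proof (rule groupI)
  fix g h assume "g \<in> carrier H" "h \<in> carrier H"
  thus "g \<otimes>\<^bsub>H\<^esub> h \<in> carrier H"
    by (auto elim!: in_carrierE simp: e_mult simp flip: power_add)
next
  show "\<one>\<^bsub>H\<^esub> \<in> carrier H" by (simp add: one_eq)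
next
  fix g h k assume "g \<in> carrier H" "h \<in> carrier H" "k \<in> carrier H"
  thus "g \<otimes>\<^bsub>H\<^esub> h \<otimes>\<^bsub>H\<^esub> k = g \<otimes>\<^bsub>H\<^esub> (h \<otimes>\<^bsub>H\<^esub> k)"
    by (auto elim!: in_carrierE simp: e_mult algebra_simps)
next
  fix g assume "g \<in> carrier H"
  thus "\<one>\<^bsub>H\<^esub> \<otimes>\<^bsub>H\<^esub> g = g" by (auto elim!: in_carrierE simp: e_mult one_eq)
next
  fix g assume "g \<in> carrier H"
  then obtain j x y z where g: "g = e (u ^ j) x y z" by (rule in_carrierE)
  define b where "b = ui ^ j"
  have b: "[b * u ^ j = 1] (mod N)" unfolding b_def by (rule ui)
  have "[y + (- (y * b)) * u ^ j = 0] (mod N)"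
  proof -
    have "[y * (b * u ^ j) = y * 1] (mod N)" using b by (rule cong_scalar_left)
    hence "[y - y * (b * u ^ j) = y - y * 1] (mod N)" by (intro cong_diff cong_refl)
    thus ?thesis by (simp add: mult.assoc)
  qed
  hence "e b (- (b * x)) (- (y * b)) (- z + y * b * x) \<otimes>\<^bsub>H\<^esub> g = \<one>\<^bsub>H\<^esub>"
    using b by (simp add: g e_mult one_eq e_eq_iff)
  moreover have "b = u ^ ((M - 1) * j)" by (simp add: b_def ui_def power_mult)
  ultimately show "\<exists>h\<in>carrier H. h \<otimes>\<^bsub>H\<^esub> g = \<one>\<^bsub>H\<^esub>" by (metis e_in)
qed

lemma finite_heis: "finite (carrier H)"
proof (rule finite_subset)
  show "carrier H \<subseteq> {0..<N} \<times> {0..<N} \<times> {0..<N} \<times> {0..<N}"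
    using N by (auto simp: heis_def heis_elem_def)
qed auto

lemma u_cong_cancel:
  assumes "n dvd N" "[k * u ^ i = l * u ^ i] (mod n)"
  shows "[k = l] (mod n)"
proof -
  have "coprime (u ^ i) n" using coprime_u[of i] assms(1) by (meson coprime_divisors dvd_refl)
  thus ?thesis using assms(2) cong_mult_rcancel[of "u ^ i" n k l] by (simp add: coprime_commute)
qed

section \<open>Degrees that occur\<close>

text \<open>
  The matrices act from the right on rows \<open>(1, s, t)\<close>, hence the group acts on functions of the form
  \<open>f(s) \<omega>(t)\<close>. Letting the coordinates \<open>y\<close> and \<open>z\<close> act through their multiples by \<open>n2\<close> keeps this an action and
  makes the central character trivial exactly on the multiples of \<open>n1\<close>. The representation is this one on the
  orbit of \<open>s = 1\<close>, which consists of the residues \<open>n2 y + u\<^sup>i\<close>: there are \<open>m\<close> possibilities modulo \<open>n2\<close> and, for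
  each of them, \<open>n1\<close> lifts. The element with \<open>x = 1\<close> has the weight \<open>\<omega>(s)\<close> at \<open>s\<close>.
\<close>
lemma degree_in_cd:
  assumes N12: "N = int n1 * int n2" and m: "m > 0" "\<And>k. [u ^ k = 1] (mod int n2) \<longleftrightarrow> m dvd k"
  shows "n1 * m \<in> cd H"
proof -
  define X where "X = {(int n2 * y + u ^ i) mod N | y i. True}"
  define p :: "int \<times> int \<times> int \<times> int \<Rightarrow> int \<Rightarrow> int" where "p = (\<lambda>(a, x, y, z) s. (int n2 * y + a * s) mod N)"
  define c :: "int \<times> int \<times> int \<times> int \<Rightarrow> int \<Rightarrow> complex" where "c = (\<lambda>(a, x, y, z) s. \<omega> (int n2 * z + s * x))"
  have n12: "n1 > 0" "n2 > 0" using N N12 by (auto intro!: gr0I)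
  have n2N: "int n2 dvd N" using N12 by simp
  have pe: "p (e a x y z) s = (int n2 * y + a * s) mod N" for a x y z s
    by (auto simp: p_def heis_elem_def simp flip: cong_def intro!: cong_add cong_mult)
  have ce: "c (e a x y z) s = \<omega> (int n2 * z + s * x)" for a x y z s
    by (auto simp: c_def heis_elem_def root_char_eq_iff[OF N] intro!: cong_add cong_mult)
  have \<omega>_mod: "\<omega> (a + k mod N * x) = \<omega> (a + k * x)" for a k x
    by (auto simp: root_char_eq_iff[OF N] intro!: cong_add cong_mult)
  have mm: "(k + a * (b mod N)) mod N = (k + a * b) mod N" for k a b
    by (auto simp flip: cong_def intro!: cong_add cong_mult)
  have XE: "s \<in> X \<longleftrightarrow> (\<exists>y i. s = (int n2 * y + u ^ i) mod N)" for s by (auto simp: X_def)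
  have "\<exists>R. irreducible_rep H (card X) R"
  proof (rule monomial_rep_irreducible[OF group_heis, where \<pi> = p and c = c and B = "{e 1 1 0 0}"])
    have "X \<subseteq> {0..<N}" using N by (auto simp: X_def)
    thus "finite X" by (rule finite_subset) auto
    show "X \<noteq> {}" by (auto simp: X_def)
  next
    fix g s assume "g \<in> carrier H" "s \<in> X"
    then obtain j x y z y' i where "g = e (u ^ j) x y z" "s = (int n2 * y' + u ^ i) mod N"
      by (auto elim!: in_carrierE simp: XE)
    hence "p g s = (int n2 * (y + u ^ j * y') + u ^ (j + i)) mod N"
      by (simp only: pe mm power_add) (simp add: algebra_simps)
    thus "p g s \<in> X" unfolding XE by blast
  next
    fix s assume "s \<in> X"
    thus "p \<one>\<^bsub>H\<^esub> s = s" by (auto simp: one_eq pe XE)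
    show "c \<one>\<^bsub>H\<^esub> s = 1" by (simp add: one_eq ce root_char_def)
  next
    fix g h s assume "g \<in> carrier H" "h \<in> carrier H" "s \<in> X"
    then obtain j x y z j' x' y' z' where gh: "g = e (u ^ j) x y z" "h = e (u ^ j') x' y' z'"
      by (auto elim!: in_carrierE)
    show "p (g \<otimes>\<^bsub>H\<^esub> h) s = p h (p g s)"
      unfolding gh e_mult pe mm by (simp add: algebra_simps)
    show "c (g \<otimes>\<^bsub>H\<^esub> h) s = c g s * c h (p g s)"
      unfolding gh e_mult pe ce \<omega>_mod root_char_add[symmetric] by (simp add: algebra_simps)
  next
    fix s s' assume "s \<in> X" "s' \<in> X"
    then obtain y i y' i' where s: "s = (int n2 * y + u ^ i) mod N" "s' = (int n2 * y' + u ^ i') mod N"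
      by (auto simp: XE)
    define a where "a = u ^ ((M - 1) * i + i')"
    have A: "a * u ^ i = ui ^ i * u ^ i * u ^ i'"
      by (simp add: a_def ui_def power_add power_mult)
    have "[a * u ^ i = 1 * u ^ i'] (mod N)"
      unfolding A using cong_scalar_right[OF ui[of i], of "u ^ i'"] .
    hence "[int n2 * y' + a * u ^ i = int n2 * y' + u ^ i'] (mod N)" by (intro cong_add) auto
    hence "p (e a 0 (y' - a * y) 0) s = s'"
      unfolding pe s mm cong_def by (simp add: algebra_simps)
    thus "\<exists>g\<in>carrier H. p g s = s'" unfolding a_def by (metis e_in)
  next
    fix s s' assume s: "s \<in> X" "s' \<in> X" "s \<noteq> s'"
    hence "s mod N = s" "s' mod N = s'" by (auto simp: XE)
    hence "\<not> [s = s'] (mod N)" using s by (simp add: cong_def)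
    thus "\<exists>b\<in>{e 1 1 0 0}. c b s \<noteq> c b s'" by (simp add: ce root_char_eq_iff[OF N])
  qed (auto simp: pe XE)
  moreover have "card X = n1 * m"
  proof -
    let ?f = "\<lambda>(y, i). (int n2 * int y + u ^ i) mod N"
    have "bij_betw ?f ({..<n1} \<times> {..<m}) X"
    proof (rule bij_betw_imageI)
      show "inj_on ?f ({..<n1} \<times> {..<m})"
      proof (rule inj_onI)
        fix a b assume "a \<in> {..<n1} \<times> {..<m}" "b \<in> {..<n1} \<times> {..<m}" "?f a = ?f b"
        moreover obtain y i y' i' where ab: "a = (y, i)" "b = (y', i')" by (cases a, cases b) auto
        ultimately have lt: "y < n1" "i < m" "y' < n1" "i' < m"
          and eq: "(int n2 * int y + u ^ i) mod N = (int n2 * int y' + u ^ i') mod N" by auto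
        have c: "[int n2 * int y + u ^ i = int n2 * int y' + u ^ i'] (mod N)"
          using eq by (simp add: cong_def)
        have "[int n2 * int y + u ^ i = int n2 * int y' + u ^ i'] (mod int n2)"
          using cong_dvd_modulus[OF c n2N] .
        hence c2: "[u ^ i = u ^ i'] (mod int n2)" by (simp add: cong_def)
        have *: "a = b" if "a \<le> b" "a < m" "b < m" "[u ^ a = u ^ b] (mod int n2)" for a b
        proof -
          have "[1 * u ^ a = u ^ (b - a) * u ^ a] (mod int n2)" using that by (simp flip: power_add)
          hence "[u ^ (b - a) = 1] (mod int n2)" using u_cong_cancel[OF n2N] cong_sym by blast
          hence "m dvd b - a" using m by simp
          thus ?thesis using that by (auto dest: dvd_imp_le)
        qed
        have ii: "i = i'"
          using *[of i i'] *[of i' i] c2 lt cong_sym by (cases "i \<le> i'") auto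
        hence "[int n2 * int y = int n2 * int y'] (mod N)" using c by (simp add: cong_add_rcancel)
        hence "N dvd int n2 * (int y - int y')" by (simp add: cong_iff_dvd_diff algebra_simps)
        hence "int n1 dvd int y - int y'" unfolding N12 using n12 by (simp add: mult.commute)
        hence "[int y = int y'] (mod int n1)" by (simp add: cong_iff_dvd_diff)
        hence "y = y'" using lt by (simp add: cong_def)
        thus "a = b" using ii ab by simp
      qed
      show "?f ` ({..<n1} \<times> {..<m}) = X"
      proof (intro equalityI subsetI)
        fix s assume "s \<in> X"
        then obtain y i where s: "s = (int n2 * y + u ^ i) mod N" by (auto simp: XE)
        have "[u ^ (m * (i div m)) = 1] (mod int n2)" by (simp add: m)
        hence "[u ^ (m * (i div m)) * u ^ (i mod m) = 1 * u ^ (i mod m)] (mod int n2)"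
          by (rule cong_scalar_right)
        hence "[u ^ i = u ^ (i mod m)] (mod int n2)" by (simp flip: power_add)
        then obtain w where w: "u ^ i = u ^ (i mod m) + int n2 * w"
          unfolding cong_iff_lin by (metis cong_iff_lin cong_sym_eq mult.commute add.commute)
        define y' where "y' = nat ((y + w) mod int n1)"
        have y': "int y' = (y + w) mod int n1" "y' < n1" using n12 by (auto simp: y'_def nat_less_iff)
        have "int n2 * int y' = int n2 * (y + w) mod N"
          by (simp only: y'(1) mult_mod_right N12 mult.commute[of "int n1"])
        hence "[int n2 * int y' = int n2 * (y + w)] (mod N)" by (simp add: cong_def)
        hence "[int n2 * int y' + u ^ (i mod m) = int n2 * (y + w) + u ^ (i mod m)] (mod N)"
          by (intro cong_add cong_refl)
        hence fs: "s = ?f (y', i mod m)" unfolding s w cong_def by (simp add: algebra_simps)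
        show "s \<in> ?f ` ({..<n1} \<times> {..<m})"
          by (rule image_eqI[where x = "(y', i mod m)"]) (use fs y' m in auto)
      qed (auto simp: XE)
    qed
    from bij_betw_same_card[OF this] show ?thesis by simp
  qed
  ultimately show ?thesis using mem_cd_iff[OF group_heis] by simp
qed

end

section \<open>A bound for all degrees\<close>

context twisted_heis begin

text \<open>An eigenvector of \<open>f 1\<close> is one of the whole cyclic group, and its eigenvalues are roots of unity.\<close>
lemma one_parameter_weight:
  assumes R: "complex_rep H d R"
    and f: "\<And>k. f k \<in> carrier H" "\<And>k l. f (k + l) = f k \<otimes>\<^bsub>H\<^esub> f l"
      "f 0 = \<one>\<^bsub>H\<^esub>" "f N = \<one>\<^bsub>H\<^esub>"
    and v: "v \<in> carrier_vec d" "v \<noteq> 0\<^sub>v d" and c: "R (f 1) *\<^sub>v v = c \<cdot>\<^sub>v v"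
  shows "\<exists>s. c = \<omega> s \<and> (\<forall>k. R (f k) *\<^sub>v v = \<omega> (s * k) \<cdot>\<^sub>v v)"
proof -
  have R1: "R \<one>\<^bsub>H\<^esub> *\<^sub>v v = v" using complex_rep_one[OF group_heis R] v by simp
  have pw: "R (f (int k)) *\<^sub>v v = c ^ k \<cdot>\<^sub>v v" for k
  proof (induction k)
    case 0
    then show ?case using f R1 by simp
  next
    case (Suc k)
    have "f (int (Suc k)) = f (int k) \<otimes>\<^bsub>H\<^esub> f 1" by (simp flip: f(2) add: add.commute)
    hence "R (f (int (Suc k))) *\<^sub>v v = R (f (int k)) *\<^sub>v (c \<cdot>\<^sub>v v)"
      using complex_rep_act[OF R f(1) f(1) v(1)] c by simp
    also have "\<dots> = c \<cdot>\<^sub>v (c ^ k \<cdot>\<^sub>v v)"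
      using mult_mat_vec[OF complex_rep_carrier[OF R f(1)] v(1)] Suc by simp
    finally show ?case by (simp add: smult_smult_assoc)
  qed
  have "c ^ nat N \<cdot>\<^sub>v v = v" using pw[of "nat N"] N f R1 by simp
  hence "c ^ nat N \<cdot>\<^sub>v v = 1 \<cdot>\<^sub>v v" by simp
  hence "c ^ nat N = 1" using smult_vec_cancel[OF v] by blast
  then obtain s where s: "c = \<omega> s" using root_char_surj[OF N] by blast
  have fmult: "f (N * m) = \<one>\<^bsub>H\<^esub>" for m
  proof -
    interpret group H by (rule group_heis)
    have nat: "f (N * int k) = \<one>\<^bsub>H\<^esub>" for k
      by (induction k) (simp_all add: f distrib_left)
    have "f (N * int k + N * (- int k)) = f (N * (- int k))" for k unfolding f(2) nat using f by simp
    hence "f (N * (- int k)) = \<one>\<^bsub>H\<^esub>" for k using f(3) by simp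
    thus ?thesis using nat by (cases m rule: int_cases2) auto
  qed
  have "R (f k) *\<^sub>v v = \<omega> (s * k) \<cdot>\<^sub>v v" for k
  proof -
    interpret group H by (rule group_heis)
    have "f k = f (N * (k div N)) \<otimes>\<^bsub>H\<^esub> f (k mod N)" by (simp flip: f(2))
    hence "f k = f (int (nat (k mod N)))" using fmult f N by simp
    hence "R (f k) *\<^sub>v v = \<omega> (s * (k mod N)) \<cdot>\<^sub>v v"
      using pw[of "nat (k mod N)"] N by (simp add: s root_char_power)
    moreover have "\<omega> (s * (k mod N)) = \<omega> (s * k)"
      by (simp add: root_char_eq_iff[OF N] cong_def mod_simps)
    ultimately show ?thesis by simp
  qed
  thus ?thesis using s by blast
qed

text \<open>
  The centre acts by a character \<open>z \<mapsto> \<omega>(z0 z)\<close>. Put \<open>n2 = gcd(z0, N)\<close> and \<open>n1 = N / n2\<close>. The elements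
  \<open>(1, x, n1 l, z)\<close> commute as operators, so they have a common eigenvector with weight
  \<open>\<omega>(s x + t l + z0 z)\<close>. Translating it by an element \<open>(1, 0, y, 0)\<close> shifts \<open>s\<close> by a multiple of \<open>z0\<close>, and as \<open>z0\<close>
  is a unit modulo \<open>n1\<close>, one can reach \<open>n1 dvd s\<close>. After this normalisation the stabiliser of the weight is
  the semidirect product of those elements and the powers of \<open>u\<close> that fix \<open>s\<close> and \<open>t\<close> modulo \<open>N\<close>. These powers
  commute with each other and preserve the weight space, so it contains a common eigenvector of the whole
  stabiliser. The degree is then the index of the stabiliser, namely \<open>n1\<close> (for \<open>y\<close> modulo \<open>n1\<close>) times the
  least positive \<open>j\<close> such that \<open>u\<^sup>j\<close> fixes \<open>s\<close> and \<open>t\<close>. As \<open>n1\<close> divides \<open>s\<close> and \<open>t\<close>, every \<open>u\<^sup>k\<close> that is \<open>1\<close>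
  modulo \<open>n2\<close> fixes them. The assumption on \<open>N\<close> holds whenever \<open>N\<close> is squarefree.
\<close>
lemma degree_bound:
  assumes "d \<in> cd H" and sqf: "\<And>k. coprime (gcd k N) (N div gcd k N)"
  shows "\<exists>n1 n2 j :: nat. N = int n1 * int n2 \<and> d = n1 * j \<and>
           (\<forall>k. [u ^ k = 1] (mod int n2) \<longrightarrow> j dvd k)"
proof -
  interpret group H by (rule group_heis)
  obtain R where irr: "irreducible_rep H d R" using assms mem_cd_iff[OF group_heis] by auto
  hence R: "complex_rep H d R" and d: "d > 0"
    and sub: "\<And>W. lin_subspace d W \<Longrightarrow> \<forall>g\<in>carrier H. \<forall>w\<in>W. R g *\<^sub>v w \<in> W \<Longrightarrow> W = {0\<^sub>v d} \<or> W = carrier_vec d"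
    unfolding irreducible_rep_def by auto
  note Rc = complex_rep_carrier[OF R] and act = complex_rep_act[OF R]
  note fo = complex_rep_finite_order[OF group_heis finite_heis R]
  have Rcv: "R g *\<^sub>v v \<in> carrier_vec d" if "g \<in> carrier H" "v \<in> carrier_vec d" for g v
    using Rc[OF that(1)] that(2) by auto
  have sm: "R g *\<^sub>v (c \<cdot>\<^sub>v v) = c \<cdot>\<^sub>v (R g *\<^sub>v v)" if "g \<in> carrier H" "v \<in> carrier_vec d" for g c v
    using mult_mat_vec[OF Rc[OF that(1)] that(2)] .
  have add: "R g *\<^sub>v (v + w) = R g *\<^sub>v v + R g *\<^sub>v w"
    if "g \<in> carrier H" "v \<in> carrier_vec d" "w \<in> carrier_vec d" for g v w
    using mult_add_distrib_mat_vec[OF Rc[OF that(1)] that(2,3)] .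
  have nz: "R g *\<^sub>v v \<noteq> 0\<^sub>v d" if g: "g \<in> carrier H" and v: "v \<in> carrier_vec d" "v \<noteq> 0\<^sub>v d" for g v
  proof
    assume "R g *\<^sub>v v = 0\<^sub>v d"
    moreover have "R (inv\<^bsub>H\<^esub> g) *\<^sub>v (R g *\<^sub>v v) = v"
      using act[of "inv\<^bsub>H\<^esub> g" g v] g v complex_rep_one[OF group_heis R] by simp
    ultimately show False using v Rc[of "inv\<^bsub>H\<^esub> g"] g by auto
  qed
  have eig_sub: "lin_subspace d {w \<in> carrier_vec d. \<forall>b\<in>B. R (\<beta> b) *\<^sub>v w = c b \<cdot>\<^sub>v w}"
    if \<beta>: "\<And>b. b \<in> B \<Longrightarrow> \<beta> b \<in> carrier H" for B :: "'b set" and \<beta> c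
  proof -
    have z: "x \<cdot>\<^sub>v 0\<^sub>v d = 0\<^sub>v d" for x :: complex by (intro eq_vecI) auto
    have "R g *\<^sub>v 0\<^sub>v d = 0\<^sub>v d" if "g \<in> carrier H" for g using Rc[OF that] by auto
    thus ?thesis using sm add \<beta> z unfolding lin_subspace_iff
      by (auto simp: smult_add_distrib_vec[of _ d] smult_smult_assoc mult.commute)
  qed
  have full: "lin_subspace d (carrier_vec d)" unfolding lin_subspace_iff by auto
  have unit: "unit_vec d 0 \<in> carrier_vec d" "unit_vec d 0 \<noteq> (0\<^sub>v d :: complex vec)"
    using d by (auto simp: vec_eq_iff unit_vec_def)

  \<comment> \<open>Schur: the eigenspace of the central element \<open>?Z\<close> is invariant, so \<open>?Z\<close> acts as a scalar.\<close>
  let ?Z = "e 1 0 0 1"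
  obtain k where k: "k > 0" "R ?Z ^\<^sub>m k = 1\<^sub>m d" using fo[of ?Z] by auto
  obtain w c where w: "w \<in> carrier_vec d" "w \<noteq> 0\<^sub>v d" "R ?Z *\<^sub>v w = c \<cdot>\<^sub>v w"
    using finite_order_eigenvector[OF Rc k full, of "unit_vec d 0"] unit Rcv[OF e1_in] by auto
  let ?E = "{x \<in> carrier_vec d. \<forall>b\<in>{()}. R ?Z *\<^sub>v x = c \<cdot>\<^sub>v x}"
  have "?E = {0\<^sub>v d} \<or> ?E = carrier_vec d"
  proof (rule sub)
    show "lin_subspace d ?E" using eig_sub[of "{()}" "\<lambda>_. ?Z" "\<lambda>_. c"] by simp
    show "\<forall>g\<in>carrier H. \<forall>w\<in>?E. R g *\<^sub>v w \<in> ?E"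
    proof safe
      fix g x assume g: "g \<in> carrier H" and x: "x \<in> carrier_vec d" "\<forall>b\<in>{()}. R ?Z *\<^sub>v x = c \<cdot>\<^sub>v x"
      have "?Z \<otimes>\<^bsub>H\<^esub> g = g \<otimes>\<^bsub>H\<^esub> ?Z" using g by (auto elim!: in_carrierE simp: e_mult add.commute)
      hence "R ?Z *\<^sub>v (R g *\<^sub>v x) = R g *\<^sub>v (c \<cdot>\<^sub>v x)" using act g x by (metis e1_in singletonI)
      thus "R ?Z *\<^sub>v (R g *\<^sub>v x) = c \<cdot>\<^sub>v (R g *\<^sub>v x)" using sm g x by simp
    qed (use Rcv in auto)
  qed
  hence Zall: "R ?Z *\<^sub>v x = c \<cdot>\<^sub>v x" if "x \<in> carrier_vec d" for x using w that by auto
  obtain z0 where z0: "c = \<omega> z0"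
    using one_parameter_weight[OF R, of "\<lambda>k. e 1 0 0 k" w c] w
    by (auto simp: e_mult one_eq e_eq_iff cong_0_iff)
  have Z: "R (e 1 0 0 k) *\<^sub>v x = \<omega> (z0 * k) \<cdot>\<^sub>v x" if x: "x \<in> carrier_vec d" for x k
  proof (cases "x = 0\<^sub>v d")
    case True
    have "R (e 1 0 0 k) *\<^sub>v 0\<^sub>v d = 0\<^sub>v d" using Rc[of "e 1 0 0 k"] by auto
    thus ?thesis unfolding True by (auto intro!: eq_vecI)
  next
    case False
    obtain s where s: "c = \<omega> s" "\<forall>k. R (e 1 0 0 k) *\<^sub>v x = \<omega> (s * k) \<cdot>\<^sub>v x"
      using one_parameter_weight[OF R, of "\<lambda>k. e 1 0 0 k" x c] x False Zall
      by (auto simp: e_mult one_eq e_eq_iff cong_0_iff)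
    have "[s = z0] (mod N)" using s(1) z0 root_char_eq_iff[OF N, of s z0] by metis
    hence "\<omega> (s * k) = \<omega> (z0 * k)" unfolding root_char_eq_iff[OF N] by (rule cong_scalar_right)
    thus ?thesis using s(2) by simp
  qed

  define n2 where "n2 = nat (gcd z0 N)"
  define n1 where "n1 = nat (N div gcd z0 N)"
  have gN: "gcd z0 N > 0" using N by simp
  have N12: "N = int n1 * int n2" and n2: "int n2 = gcd z0 N"
    using N gN unfolding n1_def n2_def by (auto simp: pos_imp_zdiv_nonneg_iff)
  have n12: "n1 > 0" "n2 > 0" using N N12 by (auto intro!: gr0I)
  have cop: "coprime (int n2) (int n1)" using sqf[of z0] N gN unfolding n1_def n2_def
    by (simp add: pos_imp_zdiv_nonneg_iff)
  have cop_e: "coprime z0 (int n1)"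
  proof (rule coprimeI)
    fix x assume x: "x dvd z0" "x dvd int n1"
    hence "x dvd int n2" unfolding n2 using N12 by auto
    thus "is_unit x" using cop x coprime_common_divisor by blast
  qed
  have Nz: "N dvd z0 * int n1" using n2 N12 by (metis gcd_dvd1 mult.commute mult_dvd_mono dvd_refl)
  have Nz_iff: "N dvd int n2 * (z0 * k) \<longleftrightarrow> int n1 dvd k" for k
    using N12 n12 cop_e by (simp add: mult.commute coprime_dvd_mult_left_iff coprime_dvd_mult_right_iff coprime_commute)

  \<comment> \<open>\<open>?X\<close> and \<open>?Y\<close> commute up to the \<open>n1\<close>-th power of \<open>?Z\<close>, which acts trivially as \<open>N dvd z0 * n1\<close>.\<close>
  let ?X = "e 1 1 0 0" and ?Y = "e 1 0 (int n1) 0"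
  have "\<exists>v\<in>carrier_vec d. v \<noteq> 0\<^sub>v d \<and> (\<forall>A\<in>{R ?X, R ?Y}. \<exists>c. A *\<^sub>v v = c \<cdot>\<^sub>v v)"
  proof (rule common_eigenvector[OF _ full])
    have "R ?Y *\<^sub>v (R ?X *\<^sub>v x) = R ?X *\<^sub>v (R ?Y *\<^sub>v x)" if x: "x \<in> carrier_vec d" for x
    proof -
      have "?Y \<otimes>\<^bsub>H\<^esub> ?X = ?X \<otimes>\<^bsub>H\<^esub> ?Y \<otimes>\<^bsub>H\<^esub> e 1 0 0 (int n1)" by (simp add: e_mult)
      hence "R ?Y *\<^sub>v (R ?X *\<^sub>v x) = R (?X \<otimes>\<^bsub>H\<^esub> ?Y) *\<^sub>v (R (e 1 0 0 (int n1)) *\<^sub>v x)"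
        using act x by (metis e1_in m_closed)
      also have "R (e 1 0 0 (int n1)) *\<^sub>v x = x"
        using Z[OF x] root_char_eq_1_iff[OF N, of "z0 * int n1"] Nz by simp
      finally show ?thesis using act x by simp
    qed
    thus "\<And>A A' x. A \<in> {R ?X, R ?Y} \<Longrightarrow> A' \<in> {R ?X, R ?Y} \<Longrightarrow> x \<in> carrier_vec d
        \<Longrightarrow> A *\<^sub>v (A' *\<^sub>v x) = A' *\<^sub>v (A *\<^sub>v x)" by auto
    show "\<And>A. A \<in> {R ?X, R ?Y} \<Longrightarrow> \<exists>k>0. A ^\<^sub>m k = 1\<^sub>m d"
      using fo[OF e1_in] by blast
  qed (use Rc[OF e1_in] unit Rcv[OF e1_in] in auto)
  then obtain v0 cX cY where v0: "v0 \<in> carrier_vec d" "v0 \<noteq> 0\<^sub>v d"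
    "R ?X *\<^sub>v v0 = cX \<cdot>\<^sub>v v0" "R ?Y *\<^sub>v v0 = cY \<cdot>\<^sub>v v0" by auto
  obtain s0 where s0: "\<And>k. R (e 1 k 0 0) *\<^sub>v v0 = \<omega> (s0 * k) \<cdot>\<^sub>v v0"
    using one_parameter_weight[OF R, of "\<lambda>k. e 1 k 0 0" v0 cX] v0
    by (auto simp: e_mult one_eq e_eq_iff cong_0_iff)
  obtain t where t: "\<And>k. R (e 1 0 (int n1 * k) 0) *\<^sub>v v0 = \<omega> (t * k) \<cdot>\<^sub>v v0"
    using one_parameter_weight[OF R, of "\<lambda>k. e 1 0 (int n1 * k) 0" v0 cY] v0
    by (auto simp: e_mult one_eq e_eq_iff cong_0_iff distrib_left add.commute)
  \<comment> \<open>Translation by \<open>y0\<close> replaces the weight \<open>s0\<close> by \<open>s0 - z0 * y0\<close>, made divisible by \<open>n1\<close>.\<close>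
  obtain y1 where y1: "[z0 * y1 = 1] (mod int n1)" using cong_solve_coprime_int[OF cop_e] by auto
  define y0 where "y0 = s0 * y1"
  define s where "s = s0 - z0 * y0"
  have s: "int n1 dvd s"
  proof -
    have "[s0 * (z0 * y1) = s0 * 1] (mod int n1)" using y1 by (rule cong_scalar_left)
    hence "[s0 = z0 * y0] (mod int n1)" by (simp add: y0_def cong_sym_eq mult.left_commute)
    thus ?thesis by (simp add: s_def cong_iff_dvd_diff)
  qed
  define v1 where "v1 = R (e 1 0 y0 0) *\<^sub>v v0"
  have v1: "v1 \<in> carrier_vec d" "v1 \<noteq> 0\<^sub>v d" unfolding v1_def using v0 Rcv nz by auto
  have v1X: "R (e 1 k 0 0) *\<^sub>v v1 = \<omega> (s * k) \<cdot>\<^sub>v v1" for k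
  proof -
    have "e 1 k 0 0 \<otimes>\<^bsub>H\<^esub> e 1 0 y0 0 = e 1 0 0 (- (y0 * k)) \<otimes>\<^bsub>H\<^esub> (e 1 0 y0 0 \<otimes>\<^bsub>H\<^esub> e 1 k 0 0)"
      by (simp add: e_mult)
    hence "R (e 1 k 0 0) *\<^sub>v v1 = R (e 1 0 0 (- (y0 * k))) *\<^sub>v (R (e 1 0 y0 0) *\<^sub>v (R (e 1 k 0 0) *\<^sub>v v0))"
      unfolding v1_def using act v0 by (metis e1_in m_closed)
    also have "\<dots> = \<omega> (z0 * - (y0 * k)) \<cdot>\<^sub>v (\<omega> (s0 * k) \<cdot>\<^sub>v v1)"
      using s0 sm v0 v1 Z unfolding v1_def by (simp add: Rcv smult_smult_assoc mult.commute)
    finally show ?thesis by (simp add: smult_smult_assoc s_def algebra_simps flip: root_char_add)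
  qed
  have v1Y: "R (e 1 0 (int n1 * k) 0) *\<^sub>v v1 = \<omega> (t * k) \<cdot>\<^sub>v v1" for k
  proof -
    have "e 1 0 (int n1 * k) 0 \<otimes>\<^bsub>H\<^esub> e 1 0 y0 0 = e 1 0 y0 0 \<otimes>\<^bsub>H\<^esub> e 1 0 (int n1 * k) 0"
      by (simp add: e_mult add.commute)
    hence "R (e 1 0 (int n1 * k) 0) *\<^sub>v v1 = R (e 1 0 y0 0) *\<^sub>v (R (e 1 0 (int n1 * k) 0) *\<^sub>v v0)"
      unfolding v1_def using act v0 by (metis e1_in)
    also have "\<dots> = \<omega> (t * k) \<cdot>\<^sub>v v1" using t sm v0 unfolding v1_def by simp
    finally show ?thesis .
  qed
  have v1B: "R (e 1 x (int n1 * l) z) *\<^sub>v v1 = \<omega> (s * x + t * l + z0 * z) \<cdot>\<^sub>v v1" for x l z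
  proof -
    have "e 1 x (int n1 * l) z = e 1 x 0 0 \<otimes>\<^bsub>H\<^esub> (e 1 0 0 z \<otimes>\<^bsub>H\<^esub> e 1 0 (int n1 * l) 0)"
      by (simp add: e_mult)
    hence "R (e 1 x (int n1 * l) z) *\<^sub>v v1 = R (e 1 x 0 0) *\<^sub>v (R (e 1 0 0 z) *\<^sub>v (R (e 1 0 (int n1 * l) 0) *\<^sub>v v1))"
      using act v1 by (simp add: Rcv)
    also have "\<dots> = \<omega> (t * l) \<cdot>\<^sub>v (\<omega> (z0 * z) \<cdot>\<^sub>v (\<omega> (s * x) \<cdot>\<^sub>v v1))"
      using v1X v1Y Z sm v1 by simp
    finally show ?thesis by (simp add: smult_smult_assoc algebra_simps flip: root_char_add)
  qed
  have tn1: "int n1 dvd t"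
  proof -
    have "e 1 0 (int n1 * int n2) 0 = \<one>\<^bsub>H\<^esub>" by (simp add: one_eq e_eq_iff cong_0_iff flip: N12)
    hence "v1 = \<omega> (t * int n2) \<cdot>\<^sub>v v1" using v1Y[of "int n2"] complex_rep_one[OF group_heis R] v1 by simp
    hence "\<omega> (t * int n2) \<cdot>\<^sub>v v1 = 1 \<cdot>\<^sub>v v1" by simp
    hence "\<omega> (t * int n2) = 1" using smult_vec_cancel[OF v1] by blast
    hence "N dvd t * int n2" using root_char_eq_1_iff[OF N] by simp
    thus ?thesis unfolding N12 using n12 by simp
  qed

  \<comment> \<open>Exponents of the powers of \<open>u\<close> in the stabiliser of the weight.\<close>
  define TU where "TU = {j. [s * u ^ j = s] (mod N) \<and> [t * u ^ j = t] (mod N)}"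
  have TU_add: "i + j \<in> TU" if i: "i \<in> TU" and j: "j \<in> TU" for i j
  proof -
    have "[r * u ^ (i + j) = r] (mod N)" if "[r * u ^ i = r] (mod N)" "[r * u ^ j = r] (mod N)" for r
      using cong_trans[OF cong_scalar_right[OF that(1), of "u ^ j"] that(2)] by (simp add: power_add mult.assoc)
    thus ?thesis using i j unfolding TU_def by blast
  qed
  have TU_diff: "j \<in> TU" if i: "i \<in> TU" and ij: "i + j \<in> TU" for i j
  proof -
    have "[r * u ^ j = r] (mod N)" if "[r * u ^ i = r] (mod N)" "[r * u ^ (i + j) = r] (mod N)" for r
    proof -
      have "[r * u ^ (i + j) = r * u ^ j] (mod N)"
        using cong_scalar_right[OF that(1), of "u ^ j"] by (simp add: power_add mult.assoc)
      thus ?thesis using that(2) cong_trans cong_sym by blast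
    qed
    thus ?thesis using i ij unfolding TU_def by blast
  qed
  have TU_mod: "k \<in> TU" if "[u ^ k = 1] (mod int n2)" for k
  proof -
    have "[r * u ^ k = r] (mod N)" if "int n1 dvd r" for r
    proof -
      have "int n2 dvd u ^ k - 1" using \<open>[u ^ k = 1] (mod int n2)\<close> by (simp add: cong_iff_dvd_diff)
      hence "N dvd r * (u ^ k - 1)" unfolding N12 using that by (intro mult_dvd_mono)
      thus ?thesis by (simp add: cong_iff_dvd_diff algebra_simps)
    qed
    thus ?thesis unfolding TU_def using s tn1 by blast
  qed
  have MTU: "M \<in> TU" using TU_mod cong_dvd_modulus[OF uM, of "int n2"] N12 by simp

  \<comment> \<open>Common eigenvector of the remaining part of the stabiliser, within the weight space of \<open>v1\<close>.\<close>
  let ?V = "{w \<in> carrier_vec d. \<forall>b\<in>UNIV. R ((\<lambda>(x, l, z). e 1 x (int n1 * l) z) b) *\<^sub>v w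
      = (\<lambda>(x, l, z). \<omega> (s * x + t * l + z0 * z)) b \<cdot>\<^sub>v w}"
  have V: "w \<in> ?V \<longleftrightarrow> w \<in> carrier_vec d \<and>
      (\<forall>x l z. R (e 1 x (int n1 * l) z) *\<^sub>v w = \<omega> (s * x + t * l + z0 * z) \<cdot>\<^sub>v w)" for w by auto
  let ?A = "\<lambda>j. e (u ^ j) 0 0 0"
  have "\<exists>v\<in>?V. v \<noteq> 0\<^sub>v d \<and> (\<forall>A\<in>(\<lambda>j. R (?A j)) ` TU. \<exists>c. A *\<^sub>v v = c \<cdot>\<^sub>v v)"
  proof (rule common_eigenvector)
    have "(\<lambda>j. R (?A j)) ` TU \<subseteq> R ` carrier H" by auto
    thus "finite ((\<lambda>j. R (?A j)) ` TU)" using finite_heis by (meson finite_imageI finite_subset)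
    show "lin_subspace d ?V" by (rule eig_sub) auto
    show "\<exists>v\<in>?V. v \<noteq> 0\<^sub>v d" using v1 v1B V by blast
  next
    fix A x assume "A \<in> (\<lambda>j. R (?A j)) ` TU" and x: "x \<in> ?V"
    then obtain j where j: "j \<in> TU" "A = R (?A j)" by auto
    have xc: "x \<in> carrier_vec d" using x by auto
    have "R (e 1 y (int n1 * l) z) *\<^sub>v (A *\<^sub>v x) = \<omega> (s * y + t * l + z0 * z) \<cdot>\<^sub>v (A *\<^sub>v x)" for y l z
    proof -
      have inv: "[u ^ j * (ui ^ j * y) = y] (mod N)"
        using cong_scalar_right[OF ui[of j], of y] by (simp add: mult_ac)
      have "e 1 y (int n1 * l) z \<otimes>\<^bsub>H\<^esub> ?A j = ?A j \<otimes>\<^bsub>H\<^esub> e 1 (ui ^ j * y) (int n1 * (l * u ^ j)) z"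
        using inv by (simp add: e_mult e_eq_iff cong_sym_eq mult.assoc)
      hence "R (e 1 y (int n1 * l) z) *\<^sub>v (A *\<^sub>v x)
          = R (?A j) *\<^sub>v (R (e 1 (ui ^ j * y) (int n1 * (l * u ^ j)) z) *\<^sub>v x)"
        unfolding j(2) using act xc by (metis e1_in e_in)
      also have "\<dots> = \<omega> (s * (ui ^ j * y) + t * (l * u ^ j) + z0 * z) \<cdot>\<^sub>v (A *\<^sub>v x)"
        using x sm xc unfolding V j(2) by simp
      also have "\<omega> (s * (ui ^ j * y) + t * (l * u ^ j) + z0 * z) = \<omega> (s * y + t * l + z0 * z)"
      proof -
        have "[s * u ^ j * (ui ^ j * y) = s * (ui ^ j * y)] (mod N)" "[t * u ^ j * l = t * l] (mod N)"
          using j cong_scalar_right unfolding TU_def by blast+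
        moreover have "[s * (u ^ j * (ui ^ j * y)) = s * y] (mod N)" using inv by (rule cong_scalar_left)
        ultimately show ?thesis unfolding root_char_eq_iff[OF N]
          by (intro cong_add) (auto simp: mult_ac intro: cong_trans cong_sym)
      qed
      finally show ?thesis .
    qed
    thus "A *\<^sub>v x \<in> ?V" unfolding V using Rcv[OF e_in xc] j by auto
  next
    fix A A' x assume "A \<in> (\<lambda>j. R (?A j)) ` TU" "A' \<in> (\<lambda>j. R (?A j)) ` TU" and x: "x \<in> ?V"
    then obtain i j where ij: "A = R (?A i)" "A' = R (?A j)" by auto
    have "?A i \<otimes>\<^bsub>H\<^esub> ?A j = ?A j \<otimes>\<^bsub>H\<^esub> ?A i" by (simp add: e_mult mult.commute)
    moreover have "x \<in> carrier_vec d" using x by auto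
    ultimately show "A *\<^sub>v (A' *\<^sub>v x) = A' *\<^sub>v (A *\<^sub>v x)"
      unfolding ij by (simp only: act[OF e_in e_in, symmetric])
  qed (use fo[OF e_in] Rc[OF e_in] in auto)
  then obtain v where "v \<in> ?V" "v \<noteq> 0\<^sub>v d" and vA: "\<And>j. j \<in> TU \<Longrightarrow> \<exists>c. R (?A j) *\<^sub>v v = c \<cdot>\<^sub>v v"
    by auto
  hence v: "v \<in> carrier_vec d" "v \<noteq> 0\<^sub>v d"
    and vB: "\<And>x l z. R (e 1 x (int n1 * l) z) *\<^sub>v v = \<omega> (s * x + t * l + z0 * z) \<cdot>\<^sub>v v"
    unfolding V by auto

  define j0 where "j0 = (LEAST j. j > 0 \<and> j \<in> TU)"
  have j0: "j0 > 0" "j0 \<in> TU" and j0_least: "\<And>j. j > 0 \<Longrightarrow> j \<in> TU \<Longrightarrow> j0 \<le> j"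
    using LeastI[of "\<lambda>j. j > 0 \<and> j \<in> TU" M] Least_le[of "\<lambda>j. j > 0 \<and> j \<in> TU"] M MTU
    unfolding j0_def by auto
  have TU_mult: "k * j0 \<in> TU" for k
    by (induction k) (use TU_add j0 in \<open>auto simp: TU_def\<close>)
  have j0_dvd: "j0 dvd k" if "k \<in> TU" for k
  proof -
    have "k mod j0 \<in> TU" using TU_diff[OF TU_mult[of "k div j0"], of "k mod j0"] that by simp
    hence "\<not> k mod j0 > 0" using j0_least[of "k mod j0"] j0 by (meson mod_less_divisor not_le)
    thus ?thesis by auto
  qed
  let ?T = "{e (u ^ j) x (int n1 * l) z | j x l z. j \<in> TU}"
  let ?I = "{..<j0} \<times> {..<n1}"
  \<comment> \<open>The cosets are separated by three elements: \<open>x = n2\<close> detects \<open>y\<close>, because \<open>N dvd n2 * s\<close> removes the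
    dependence on \<open>i\<close>; then \<open>x = 1\<close> and \<open>l = 1\<close> detect \<open>i\<close> through \<open>s\<close> and \<open>t\<close>.\<close>
  have "d = card ?I"
  proof (rule irreducible_degree_eq_transversal[OF group_heis irr, where v = v and T = ?T and
        r = "\<lambda>(i, y). e (u ^ i) 0 (int y) 0" and \<beta> = "\<lambda>(x, l). e 1 x (int n1 * l) 0" and B = UNIV and
        l = "\<lambda>(x, l) (i, y). \<omega> (s * (u ^ i * x) + t * (ui ^ i * l) + z0 * (int y * x))"])
    show "finite ?I" "?I \<noteq> {}" using j0 n12 by auto
    show "?T \<subseteq> carrier H" by auto
  next
    fix g assume "g \<in> ?T"
    then obtain j x l z where g: "g = e (u ^ j) x (int n1 * l) z" "j \<in> TU" by auto
    obtain c where c: "R (?A j) *\<^sub>v v = c \<cdot>\<^sub>v v" using vA g by auto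
    have "g = e 1 x (int n1 * 0) z \<otimes>\<^bsub>H\<^esub> (?A j \<otimes>\<^bsub>H\<^esub> e 1 0 (int n1 * l) 0)"
      unfolding g by (simp add: e_mult)
    hence "R g *\<^sub>v v = R (e 1 x (int n1 * 0) z) *\<^sub>v (R (?A j) *\<^sub>v (R (e 1 0 (int n1 * l) 0) *\<^sub>v v))"
      using act v by (metis e1_in e_in m_closed Rcv)
    also have "\<dots> = \<omega> (t * l) \<cdot>\<^sub>v (c \<cdot>\<^sub>v (\<omega> (s * x + z0 * z) \<cdot>\<^sub>v v))"
      using vB[of 0 l 0] vB[of x 0 z] c sm v by simp
    finally show "\<exists>c. R g *\<^sub>v v = c \<cdot>\<^sub>v v" by (auto simp: smult_smult_assoc)
  next
    fix g assume "g \<in> carrier H"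
    then obtain m x y z where g: "g = e (u ^ m) x y z" by (rule in_carrierE)
    define i where "i = m mod j0"
    define y0 where "y0 = nat (y mod int n1)"
    define l where "l = (y div int n1) * ui ^ i"
    have y0: "int y0 = y mod int n1" "y0 < n1" using n12 by (auto simp: y0_def nat_less_iff)
    have "[(int n1 * (y div int n1)) * (ui ^ i * u ^ i) = (int n1 * (y div int n1)) * 1] (mod N)"
      by (rule cong_scalar_left[OF ui])
    hence "[y mod int n1 + (int n1 * (y div int n1)) * (ui ^ i * u ^ i) = y mod int n1 + (int n1 * (y div int n1)) * 1] (mod N)"
      by (intro cong_add cong_refl)
    hence "[y = int y0 + int n1 * l * u ^ i] (mod N)"
      unfolding y0 l_def by (simp add: mult_ac cong_sym_eq)
    moreover have "u ^ m = u ^ (m div j0 * j0) * u ^ i" unfolding i_def by (simp flip: power_add)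
    ultimately have "g = e (u ^ (m div j0 * j0)) x (int n1 * l) z \<otimes>\<^bsub>H\<^esub> e (u ^ i) 0 (int y0) 0"
      unfolding g e_mult e_eq_iff by simp
    moreover have "i < j0" using j0 by (simp add: i_def)
    ultimately show "\<exists>i\<in>?I. \<exists>t\<in>?T. g = t \<otimes>\<^bsub>H\<^esub> (case i of (i, y) \<Rightarrow> e (u ^ i) 0 (int y) 0)"
      using TU_mult y0 by (intro bexI[of _ "(i, y0)"] bexI[of _ "e (u ^ (m div j0 * j0)) x (int n1 * l) z"]) auto
  next
    fix b p assume "b \<in> (UNIV :: (int \<times> int) set)" and p: "p \<in> ?I"
    obtain x l i y where [simp]: "b = (x, l)" "p = (i, y)" by (cases b, cases p) auto
    have "[int n1 * l * (ui ^ i * u ^ i) = int n1 * l * 1] (mod N)"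
      by (rule cong_scalar_left[OF ui])
    moreover have "int n1 * (ui ^ i * l) * u ^ i = int n1 * l * (ui ^ i * u ^ i)" by (simp add: mult_ac)
    ultimately have "[int n1 * (ui ^ i * l) * u ^ i = int n1 * l] (mod N)" by (simp only: mult_1_right)
    hence "[int y + int n1 * l = int y + int n1 * (ui ^ i * l) * u ^ i] (mod N)"
      by (intro cong_add[OF cong_refl cong_sym])
    hence "e (u ^ i) 0 (int y) 0 \<otimes>\<^bsub>H\<^esub> e 1 x (int n1 * l) 0
        = e 1 (u ^ i * x) (int n1 * (ui ^ i * l)) (int y * x) \<otimes>\<^bsub>H\<^esub> e (u ^ i) 0 (int y) 0"
      by (simp add: e_mult e_eq_iff add.commute)
    thus "\<exists>h\<in>carrier H. (case p of (i, y) \<Rightarrow> e (u ^ i) 0 (int y) 0) \<otimes>\<^bsub>H\<^esub> (case b of (x, l) \<Rightarrow> e 1 x (int n1 * l) 0)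
        = h \<otimes>\<^bsub>H\<^esub> (case p of (i, y) \<Rightarrow> e (u ^ i) 0 (int y) 0) \<and>
        R h *\<^sub>v v = (case b of (x, l) \<Rightarrow> \<lambda>(i, y). \<omega> (s * (u ^ i * x) + t * (ui ^ i * l) + z0 * (int y * x))) p \<cdot>\<^sub>v v"
      using vB[of "u ^ i * x" "ui ^ i * l" "int y * x"]
      by (intro bexI[of _ "e 1 (u ^ i * x) (int n1 * (ui ^ i * l)) (int y * x)"]) auto
  next
    fix p q assume "p \<in> ?I" "q \<in> ?I" "p \<noteq> q"
    moreover obtain i y where p: "p = (i, y)" by (cases p)
    moreover obtain i' y' where q: "q = (i', y')" by (cases q)
    ultimately have lt: "i < j0" "i' < j0" "y < n1" "y' < n1" and ne: "i \<noteq> i' \<or> y \<noteq> y'" by auto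
    let ?L = "\<lambda>(x, l) (i, y). \<omega> (s * (u ^ i * x) + t * (ui ^ i * l) + z0 * (int y * x))"
    show "\<exists>b\<in>UNIV. ?L b p \<noteq> ?L b q"
    proof (rule ccontr)
      assume "\<not> ?thesis"
      hence eq: "?L b p = ?L b q" for b by blast
      have Ns: "N dvd int n2 * s * k" for k using s unfolding N12 by (auto simp: mult_ac)
      have "[int n2 * s * u ^ i + z0 * int y * int n2 = int n2 * s * u ^ i' + z0 * int y' * int n2] (mod N)"
        using eq[of "(int n2, 0)"] by (simp add: p q root_char_eq_iff[OF N] mult_ac)
      hence "N dvd int n2 * s * (u ^ i - u ^ i') + int n2 * (z0 * (int y - int y'))"
        by (simp add: cong_iff_dvd_diff algebra_simps)
      hence "N dvd int n2 * (z0 * (int y - int y'))" using Ns dvd_add_right_iff by blast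
      hence "[int y = int y'] (mod int n1)" unfolding Nz_iff by (simp add: cong_iff_dvd_diff)
      hence yy: "y = y'" using lt by (simp add: cong_def)
      have si: "[s * u ^ i = s * u ^ i'] (mod N)"
        using eq[of "(1, 0)"] by (simp add: p q yy root_char_eq_iff[OF N] cong_add_rcancel)
      have ti: "[t * ui ^ i = t * ui ^ i'] (mod N)"
        using eq[of "(0, 1)"] by (simp add: p q yy root_char_eq_iff[OF N] cong_add_rcancel)
      have *: False if "a < b" "b < j0" and sa: "[s * u ^ a = s * u ^ b] (mod N)"
        and ta: "[t * ui ^ a = t * ui ^ b] (mod N)" for a b
      proof -
        obtain k where k: "b = a + k" "k > 0" using \<open>a < b\<close> less_imp_add_positive by blast
        have "[s * u ^ k * u ^ a = s * u ^ a] (mod N)"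
          using sa unfolding k(1) by (simp add: power_add mult_ac cong_sym_eq)
        hence 1: "[s * u ^ k = s] (mod N)" by (rule u_cong_cancel[OF dvd_refl])
        have "[t * ui ^ a * (u ^ a * u ^ k) = t * ui ^ b * (u ^ a * u ^ k)] (mod N)"
          using ta by (rule cong_scalar_right)
        moreover have "[t * u ^ k * (ui ^ a * u ^ a) = t * u ^ k * 1] (mod N)" "[t * (ui ^ b * u ^ b) = t * 1] (mod N)"
          by (intro cong_scalar_left ui)+
        moreover have "t * ui ^ a * (u ^ a * u ^ k) = t * u ^ k * (ui ^ a * u ^ a)"
          "t * ui ^ b * (u ^ a * u ^ k) = t * (ui ^ b * u ^ b)"
          unfolding k(1) by (simp_all add: power_add mult_ac)
        ultimately have 2: "[t * u ^ k = t] (mod N)" by (metis cong_sym cong_trans mult_1_right)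
        have "k \<in> TU" unfolding TU_def using 1 2 by simp
        thus False using j0_least[of k] k that by simp
      qed
      show False using *[of i i'] *[of i' i] si ti lt ne yy cong_sym by (metis nat_neq_iff)
    qed
  qed (use v in auto)
  hence "d = n1 * j0" by simp
  thus ?thesis using N12 j0_dvd TU_mod by blast
qed

end

section \<open>Solvability\<close>

lemma (in group) derived_subset:
  assumes K: "subgroup K G" and S: "S \<subseteq> carrier G"
    and comm: "\<And>g h. g \<in> S \<Longrightarrow> h \<in> S \<Longrightarrow> \<exists>k\<in>K. g \<otimes> h = k \<otimes> (h \<otimes> g)"
  shows "derived G S \<subseteq> K"
  unfolding derived_def
proof (rule generate_subgroup_incl[OF _ K], safe)
  fix g h assume gh: "g \<in> S" "h \<in> S"
  then obtain k where k: "k \<in> K" "g \<otimes> h = k \<otimes> (h \<otimes> g)" using comm by blast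
  have c: "g \<in> carrier G" "h \<in> carrier G" "k \<in> carrier G" using gh S k subgroup.subset[OF K] by auto
  hence "g \<otimes> h \<otimes> inv g \<otimes> inv h = k" unfolding k(2) by (simp add: m_assoc r_inv)
  thus "g \<otimes> h \<otimes> inv g \<otimes> inv h \<in> K" using k by simp
qed

context twisted_heis begin

text \<open>
  The derived series descends through the elements with \<open>a = 1\<close> and the central elements \<open>(1, 0, 0, z)\<close>.
\<close>
lemma solvable_heis: "solvable H"
proof -
  interpret group H by (rule group_heis)
  let ?P = "{e 1 x y z | x y z. True}" and ?Z = "{e 1 0 0 z | z. True}"
  have inv: "inv\<^bsub>H\<^esub> (e 1 x y z) = e 1 (- x) (- y) (- z + y * x)" for x y z
    by (rule inv_equality) (auto simp: e_mult one_eq)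
  have P: "subgroup ?P H" and Z: "subgroup ?Z H"
    by (rule subgroupI; fastforce simp: inv e_mult one_eq)+
  have "derived H (carrier H) \<subseteq> ?P"
  proof (rule derived_subset[OF P])
    fix g h assume "g \<in> carrier H" "h \<in> carrier H"
    then obtain i x y z j x' y' z' where gh: "g = e (u ^ i) x y z" "h = e (u ^ j) x' y' z'"
      by (auto elim!: in_carrierE)
    obtain X Y Z where A: "g \<otimes>\<^bsub>H\<^esub> h = e (u ^ (i + j)) X Y Z"
      unfolding gh e_mult power_add[symmetric] by blast
    obtain X' Y' Z' where B: "h \<otimes>\<^bsub>H\<^esub> g = e (u ^ (i + j)) X' Y' Z'"
      unfolding gh e_mult power_add[symmetric] add.commute[of j] by blast
    define b where "b = (Y - Y') * ui ^ (i + j)"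
    have "[(Y - Y') * (ui ^ (i + j) * u ^ (i + j)) = (Y - Y') * 1] (mod N)"
      by (rule cong_scalar_left[OF ui])
    hence "[Y' + b * u ^ (i + j) = Y' + (Y - Y')] (mod N)"
      unfolding b_def by (intro cong_add[OF cong_refl]) (simp add: mult.assoc)
    hence "[Y = Y' + b * u ^ (i + j)] (mod N)" by (simp add: cong_sym_eq)
    hence "g \<otimes>\<^bsub>H\<^esub> h = e 1 (X - X') b (Z - Z' - b * X') \<otimes>\<^bsub>H\<^esub> (h \<otimes>\<^bsub>H\<^esub> g)"
      unfolding A B by (simp add: e_mult e_eq_iff)
    thus "\<exists>k\<in>?P. g \<otimes>\<^bsub>H\<^esub> h = k \<otimes>\<^bsub>H\<^esub> (h \<otimes>\<^bsub>H\<^esub> g)" by blast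
  qed auto
  moreover have "derived H S \<subseteq> ?Z" if S: "S \<subseteq> ?P" for S
  proof (rule derived_subset[OF Z])
    show "S \<subseteq> carrier H" using S by auto
    fix g h assume "g \<in> S" "h \<in> S"
    then obtain x y z x' y' z' where gh: "g = e 1 x y z" "h = e 1 x' y' z'" using S by blast
    have "g \<otimes>\<^bsub>H\<^esub> h = e 1 0 0 (y * x' - y' * x) \<otimes>\<^bsub>H\<^esub> (h \<otimes>\<^bsub>H\<^esub> g)"
      unfolding gh by (simp add: e_mult add_ac)
    thus "\<exists>k\<in>?Z. g \<otimes>\<^bsub>H\<^esub> h = k \<otimes>\<^bsub>H\<^esub> (h \<otimes>\<^bsub>H\<^esub> g)" by blast
  qed
  moreover have "derived H S \<subseteq> {\<one>\<^bsub>H\<^esub>}" if S: "S \<subseteq> ?Z" for S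
  proof (rule derived_subset[OF triv_subgroup])
    show "S \<subseteq> carrier H" using S by auto
    fix g h assume "g \<in> S" "h \<in> S"
    then obtain z z' where "g = e 1 0 0 z" "h = e 1 0 0 z'" using S by blast
    hence "g \<otimes>\<^bsub>H\<^esub> h = \<one>\<^bsub>H\<^esub> \<otimes>\<^bsub>H\<^esub> (h \<otimes>\<^bsub>H\<^esub> g)" by (simp add: e_mult one_eq add.commute)
    thus "\<exists>k\<in>{\<one>\<^bsub>H\<^esub>}. g \<otimes>\<^bsub>H\<^esub> h = k \<otimes>\<^bsub>H\<^esub> (h \<otimes>\<^bsub>H\<^esub> g)" by blast
  qed
  ultimately have "derived H (derived H (derived H (carrier H))) \<subseteq> {\<one>\<^bsub>H\<^esub>}" by meson
  moreover have "\<one>\<^bsub>H\<^esub> \<in> derived H S" for S unfolding derived_def by (rule generate.one)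
  ultimately have "(derived H ^^ 3) (carrier H) = {\<one>\<^bsub>H\<^esub>}" by (auto simp: numeral_3_eq_3)
  thus ?thesis unfolding solvable_def using trivial_derived_seq_imp_solvable[OF subgroup_self] by blast
qed

end

section \<open>Isomorphic copies on the natural numbers\<close>

lemma irreducible_rep_comp:
  assumes h: "h \<in> hom G K" "h ` carrier G = carrier K" and R: "irreducible_rep K d R"
  shows "irreducible_rep G d (R \<circ> h)"
proof -
  have "complex_rep G d (R \<circ> h)"
    using R hom_compose[OF h(1)] unfolding irreducible_rep_def complex_rep_def by blast
  moreover have "(\<forall>g\<in>carrier G. \<forall>w\<in>W. (R \<circ> h) g *\<^sub>v w \<in> W) \<longleftrightarrow> (\<forall>g\<in>carrier K. \<forall>w\<in>W. R g *\<^sub>v w \<in> W)" for W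
    unfolding h(2)[symmetric] by simp
  ultimately show ?thesis using R unfolding irreducible_rep_def by simp
qed

lemma cd_iso:
  assumes "group G" "group K" and h: "h \<in> iso G K"
  shows "cd G = cd K"
proof -
  interpret group G by fact
  have inv: "inv_into (carrier G) h \<in> iso K G" using iso_set_sym[OF h] .
  have "irreducible_rep G d (R \<circ> h)" if "irreducible_rep K d R" for d R
    using irreducible_rep_comp[OF _ _ that, of h G] h by (auto simp: iso_def bij_betw_def)
  moreover have "irreducible_rep K d (R \<circ> inv_into (carrier G) h)" if "irreducible_rep G d R" for d R
    using irreducible_rep_comp[OF _ _ that, of "inv_into (carrier G) h" K] inv
    by (auto simp: iso_def bij_betw_def)
  ultimately show ?thesis
    unfolding set_eq_iff mem_cd_iff[OF assms(1)] mem_cd_iff[OF assms(2)] by blast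
qed

lemma solvable_group_on_nat:
  fixes G :: "'a :: countable monoid"
  assumes G: "group G" "finite (carrier G)" "solvable G"
  shows "\<exists>K :: nat monoid. group K \<and> finite (carrier K) \<and> solvable K \<and> cd K = cd G"
proof -
  interpret G: group G by fact
  let ?f = "to_nat :: 'a \<Rightarrow> nat"
  let ?K = "image_group ?f G"
  have mult: "?f x \<otimes>\<^bsub>?K\<^esub> ?f y = ?f (x \<otimes>\<^bsub>G\<^esub> y)" if "x \<in> carrier G" "y \<in> carrier G" for x y
    using that by (simp add: image_group_def inv_into_f_f inj_on_def)
  have hom: "?f \<in> hom G ?K" using mult by (auto simp: hom_def image_group_carrier)
  have K: "group ?K" using G.hom_imp_img_group[OF hom] by (simp add: image_group_def)
  have iso: "?f \<in> iso G ?K"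
    using hom by (auto simp: iso_def bij_betw_def image_group_carrier inj_on_def)
  interpret gh: group_hom G ?K ?f using G K hom by (simp add: group_hom_def group_hom_axioms_def)
  have "solvable ?K" using gh.solvable_imp_solvable_img[of "carrier G"] G
    by (simp add: solvable_def image_group_carrier)
  thus ?thesis using K G cd_iso[OF G(1) K iso] by (intro exI[of _ ?K]) (auto simp: image_group_carrier)
qed

section \<open>Choice of the primes\<close>

text \<open>
  Take \<open>p\<close> to be a prime divisor of the \<open>q\<close>-th cyclotomic value \<open>1 + x + \<dots> + x\<^bsup>q-1\<^esup>\<close> at a multiple \<open>x\<close> of all
  small numbers. Then \<open>p\<close> does not divide \<open>x\<close> and so is large; \<open>x\<close> has order dividing \<open>q\<close> modulo \<open>p\<close>; and
  \<open>x = 1\<close> modulo \<open>p\<close> would give \<open>p dvd q\<close>.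
\<close>
lemma prime_with_element_of_prime_order:
  "\<exists>p q a :: nat. prime p \<and> prime q \<and> p > B \<and> q > B \<and> p \<noteq> q \<and> (\<forall>j. [a ^ j = 1] (mod p) \<longleftrightarrow> q dvd j)"
proof -
  obtain q where q: "prime q" "q > B" using bigger_prime by blast
  define x :: nat where "x = fact (q + B)"
  define \<Phi> where "\<Phi> = (\<Sum>i<q. x ^ i)"
  have q2: "q \<ge> 2" using q prime_ge_2_nat by blast
  have x0: "x > 0" by (simp add: x_def)
  have split: "\<Phi> = 1 + x * (\<Sum>i<q - 1. x ^ i)"
  proof -
    have "\<Phi> = (\<Sum>i<Suc (q - 1). x ^ i)" using q2 by (simp add: \<Phi>_def)
    also have "\<dots> = 1 + (\<Sum>i<q - 1. x ^ Suc i)" by (subst sum.lessThan_Suc_shift) simp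
    finally show ?thesis by (simp add: sum_distrib_left)
  qed
  have "x ^ 0 \<le> (\<Sum>i<q - 1. x ^ i)" using q2 by (intro member_le_sum) auto
  hence "(\<Sum>i<q - 1. x ^ i) > 0" by simp
  with x0 have "x * (\<Sum>i<q - 1. x ^ i) > 0" by (rule mult_pos_pos)
  hence "\<Phi> \<noteq> 1" unfolding split by linarith
  then obtain p where p: "prime p" "p dvd \<Phi>" using prime_factor_nat by blast
  have "\<not> p dvd x"
  proof
    assume "p dvd x"
    hence "p dvd 1" using p(2) unfolding split by (metis dvd_add_left_iff dvd_mult2)
    thus False using p(1) by auto
  qed
  hence pB: "p > q + B" using p(1) prime_dvd_fact_iff[of p "q + B"] by (simp add: x_def)
  have "[x ^ q = 1] (mod p)"
  proof -
    have "int x ^ q - 1 = (int x - 1) * int \<Phi>" by (simp add: power_diff_1_eq \<Phi>_def)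
    hence "int p dvd int (x ^ q) - int 1" using p(2) by simp
    thus ?thesis by (simp add: cong_iff_dvd_diff flip: cong_int_iff)
  qed
  hence "ord p x dvd q" using ord_divides by blast
  moreover have "ord p x \<noteq> 1"
  proof
    assume "ord p x = 1"
    hence x1: "[x = 1] (mod p)" using ord_divides[of x 1 p] by simp
    have "[\<Phi> = (\<Sum>i<q. 1 ^ i)] (mod p)" unfolding \<Phi>_def by (intro cong_sum cong_pow x1)
    hence "[\<Phi> = q] (mod p)" by simp
    hence "p dvd q" using p(2) by (simp add: cong_dvd_iff)
    thus False using pB q2 by (auto dest: dvd_imp_le)
  qed
  ultimately have "ord p x = q" using q(1) by (auto simp: prime_nat_iff)
  hence "\<forall>j. [x ^ j = 1] (mod p) \<longleftrightarrow> q dvd j" using ord_divides by metis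
  moreover have "p > B" "p \<noteq> q" using pB by auto
  ultimately show ?thesis using p(1) q by blast
qed

lemma prime_pairs_exist:
  assumes "finite I"
  shows "\<exists>p q a :: 'i \<Rightarrow> nat. (\<forall>i\<in>I. prime (p i) \<and> prime (q i) \<and> (\<forall>j. [a i ^ j = 1] (mod p i) \<longleftrightarrow> q i dvd j)) \<and>
           inj_on p I \<and> inj_on q I \<and> p ` I \<inter> q ` I = {}"
  using assms
proof (induction I rule: finite_induct)
  case empty
  then show ?case by auto
next
  case (insert k I)
  then obtain p q a :: "'i \<Rightarrow> nat" where
    IH: "\<forall>i\<in>I. prime (p i) \<and> prime (q i) \<and> (\<forall>j. [a i ^ j = 1] (mod p i) \<longleftrightarrow> q i dvd j)"
      "inj_on p I" "inj_on q I" "p ` I \<inter> q ` I = {}" by blast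
  obtain p' q' a' where
    new: "prime p'" "prime q'" "p' > (\<Sum>i\<in>I. p i + q i)" "q' > (\<Sum>i\<in>I. p i + q i)" "p' \<noteq> q'"
      "\<forall>j. [a' ^ j = 1] (mod p') \<longleftrightarrow> q' dvd j"
    using prime_with_element_of_prime_order by blast
  have le: "p i + q i \<le> (\<Sum>i\<in>I. p i + q i)" if "i \<in> I" for i
    using that insert.hyps by (intro member_le_sum) auto
  have "p i < p'" "q i < p'" "p i < q'" "q i < q'" if "i \<in> I" for i
    using le[OF that] new(3,4) by linarith+
  hence ne: "p' \<notin> p ` I" "p' \<notin> q ` I" "q' \<notin> p ` I" "q' \<notin> q ` I" by blast+
  have [simp]: "(f(k := b)) ` I = f ` I" "inj_on (f(k := b)) I \<longleftrightarrow> inj_on f I" for f :: "'i \<Rightarrow> nat" and b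
    using insert.hyps by (auto simp: inj_on_def)
  have "I - {k} = I" using insert.hyps by auto
  hence "inj_on (p(k := p')) (insert k I)" "inj_on (q(k := q')) (insert k I)"
    using IH(2,3) ne insert.hyps by auto
  moreover have "(p(k := p')) ` insert k I \<inter> (q(k := q')) ` insert k I = {}"
    using IH(4) ne new(5) insert.hyps by auto
  moreover have "\<forall>i\<in>insert k I. prime ((p(k := p')) i) \<and> prime ((q(k := q')) i) \<and>
      (\<forall>j. [(a(k := a')) i ^ j = 1] (mod (p(k := p')) i) \<longleftrightarrow> (q(k := q')) i dvd j)"
    using IH(1) new(1,2,6) by (simp only: fun_upd_apply split: if_splits) blast
  ultimately show ?case by blast
qed

lemma prod_coprime_dvd_iff:
  fixes f :: "'i \<Rightarrow> 'a :: semiring_gcd"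
  assumes "finite I" "\<And>i j. i \<in> I \<Longrightarrow> j \<in> I \<Longrightarrow> i \<noteq> j \<Longrightarrow> coprime (f i) (f j)"
  shows "(\<Prod>i\<in>I. f i) dvd x \<longleftrightarrow> (\<forall>i\<in>I. f i dvd x)"
  using assms
proof (induction I rule: finite_induct)
  case (insert k I)
  have "coprime (f k) (\<Prod>i\<in>I. f i)" using insert by (intro prod_coprime_right) auto
  hence "f k * (\<Prod>i\<in>I. f i) dvd x \<longleftrightarrow> f k dvd x \<and> (\<Prod>i\<in>I. f i) dvd x"
    by (meson divides_mult dvd_mult_left dvd_mult_right)
  thus ?case using insert by simp
qed simp

text \<open>
  In \<open>degree_bound\<close> take for \<open>T\<close> the indices of the primes \<open>p i\<close> that divide \<open>n2\<close>. Since \<open>N\<close> is squarefree,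
  \<open>n1\<close> divides the product of the other \<open>p i\<close>, and the order of \<open>u\<close> modulo \<open>n2\<close> divides the product of the
  \<open>q i\<close> with \<open>i \<in> T\<close>.
\<close>
lemma solvable_group_with_degrees:
  fixes p q :: "'i \<Rightarrow> nat"
  assumes I: "finite I"
    and pqa: "\<forall>i\<in>I. prime (p i) \<and> prime (q i) \<and> (\<forall>j. [a i ^ j = 1] (mod p i) \<longleftrightarrow> q i dvd j)"
    and inj: "inj_on p I" "inj_on q I"
  shows "\<exists>G :: nat monoid. group G \<and> finite (carrier G) \<and> solvable G \<and>
           (\<forall>T\<subseteq>I. (\<Prod>i\<in>I - T. p i) * (\<Prod>i\<in>T. q i) \<in> cd G) \<and>
           (\<forall>d\<in>cd G. \<exists>T\<subseteq>I. d dvd (\<Prod>i\<in>I - T. p i) * (\<Prod>i\<in>T. q i))"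
proof -
  have a: "prime (p i)" "prime (q i)" "[a i ^ j = 1] (mod p i) \<longleftrightarrow> q i dvd j" if "i \<in> I" for i j
    using bspec[OF pqa that] by blast+
  have copp: "coprime (p i) (p j)" if "i \<in> I" "j \<in> I" "i \<noteq> j" for i j
    using that a inj by (intro primes_coprime) (auto simp: inj_on_def)
  have copq: "coprime (q i) (q j)" if "i \<in> I" "j \<in> I" "i \<noteq> j" for i j
    using that a inj by (intro primes_coprime) (auto simp: inj_on_def)
  obtain u where u: "\<And>i. i \<in> I \<Longrightarrow> [u = a i] (mod p i)"
    using chinese_remainder_nat[OF I, of p a] copp by blast
  have ui: "[u ^ j = 1] (mod p i) \<longleftrightarrow> q i dvd j" if "i \<in> I" for i j
    using cong_pow[OF u[OF that], of j] a(3)[OF that, of j] cong_trans cong_sym by blast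
  have uT: "[int u ^ j = 1] (mod int (\<Prod>i\<in>T. p i)) \<longleftrightarrow> (\<Prod>i\<in>T. q i) dvd j" if T: "T \<subseteq> I" for T j
  proof -
    have fT: "finite T" using T I finite_subset by blast
    have "[int u ^ j = 1] (mod int (\<Prod>i\<in>T. p i)) \<longleftrightarrow> (\<Prod>i\<in>T. int (p i)) dvd int u ^ j - 1"
      by (simp add: cong_iff_dvd_diff)
    also have "\<dots> \<longleftrightarrow> (\<forall>i\<in>T. int (p i) dvd int u ^ j - 1)"
      using copp T by (intro prod_coprime_dvd_iff fT) (auto simp: subset_iff)
    also have "\<dots> \<longleftrightarrow> (\<forall>i\<in>T. [u ^ j = 1] (mod p i))"
      by (simp add: cong_iff_dvd_diff flip: cong_int_iff)
    also have "\<dots> \<longleftrightarrow> (\<forall>i\<in>T. q i dvd j)" using ui T by blast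
    also have "\<dots> \<longleftrightarrow> (\<Prod>i\<in>T. q i) dvd j"
      using copq T by (intro prod_coprime_dvd_iff[symmetric] fT) (auto simp: subset_iff)
    finally show ?thesis .
  qed
  define N where "N = (\<Prod>i\<in>I. p i)"
  have split: "N = (\<Prod>i\<in>I - T. p i) * (\<Prod>i\<in>T. p i)" if "T \<subseteq> I" for T
    unfolding N_def using prod.subset_diff[OF that I, of p] .
  have qpos: "(\<Prod>i\<in>T. q i) > 0" if "T \<subseteq> I" for T
    using that a(2) by (intro prod_pos) (auto simp: subset_iff prime_gt_0_nat)
  have N0: "N > 0" unfolding N_def using a(1) by (intro prod_pos) (auto simp: prime_gt_0_nat)
  have sqf: "squarefree N" unfolding N_def
    using copp a(1) by (intro squarefree_prod_coprime) (auto simp: squarefree_prime)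
  have cop: "coprime b c" if "N = b * c" for b c
  proof (rule coprimeI)
    fix r assume "r dvd b" "r dvd c"
    hence "r ^ 2 dvd N" unfolding that power2_eq_square by (rule mult_dvd_mono)
    thus "is_unit r" using sqf squarefreeD by blast
  qed
  have uM: "[int u ^ (\<Prod>i\<in>I. q i) = 1] (mod int N)"
    unfolding N_def by (rule iffD2[OF uT[OF order_refl] dvd_refl])
  interpret twisted_heis "int N" "int u" "\<Prod>i\<in>I. q i"
  proof unfold_locales
    show "0 < int N" using N0 by simp
    show "0 < (\<Prod>i\<in>I. q i)" by (rule qpos[OF order_refl])
    show "[int u ^ (\<Prod>i\<in>I. q i) = 1] (mod int N)" by (rule uM)
  qed
  have cop_int: "coprime (gcd k (int N)) (int N div gcd k (int N))" for k
  proof -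
    have g: "gcd k (int N) = int (gcd (nat \<bar>k\<bar>) N)" by (simp only: gcd_int_def abs_of_nat nat_int)
    have "gcd (nat \<bar>k\<bar>) N dvd N" by (rule gcd_dvd2)
    hence "N = gcd (nat \<bar>k\<bar>) N * (N div gcd (nat \<bar>k\<bar>) N)" by (metis dvd_mult_div_cancel)
    from cop[OF this] show ?thesis unfolding g zdiv_int[symmetric] by (simp only: coprime_int_iff)
  qed
  note bound = degree_bound[OF _ cop_int]
  have "\<exists>T\<subseteq>I. d dvd (\<Prod>i\<in>I - T. p i) * (\<Prod>i\<in>T. q i)" if d: "d \<in> cd H" for d
  proof -
    obtain n1 n2 j where n: "int N = int n1 * int n2" "d = n1 * j" "\<And>k. [int u ^ k = 1] (mod int n2) \<Longrightarrow> j dvd k"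
      using bound[OF d] by blast
    have N12: "N = n1 * n2" using n(1) by (metis of_nat_eq_iff of_nat_mult)
    define T where "T = {i \<in> I. p i dvd n2}"
    have T: "T \<subseteq> I" by (auto simp: T_def)
    have "coprime n2 (\<Prod>i\<in>I - T. p i)"
    proof (rule prod_coprime_right)
      fix i assume "i \<in> I - T"
      hence "coprime (p i) n2" using a(1) by (intro prime_imp_coprime) (auto simp: T_def)
      thus "coprime n2 (p i)" by (simp add: coprime_commute)
    qed
    moreover have "n2 dvd (\<Prod>i\<in>I - T. p i) * (\<Prod>i\<in>T. p i)" using N12 split[OF T] by (metis dvd_triv_right)
    ultimately have n2: "n2 dvd (\<Prod>i\<in>T. p i)" by (simp add: coprime_dvd_mult_right_iff)
    have "coprime n1 (\<Prod>i\<in>T. p i)"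
    proof (rule prod_coprime_right)
      fix i assume "i \<in> T"
      hence "p i dvd n2" by (simp add: T_def)
      thus "coprime n1 (p i)" by (rule coprime_divisors[OF dvd_refl _ cop[OF N12]])
    qed
    moreover have "n1 dvd (\<Prod>i\<in>I - T. p i) * (\<Prod>i\<in>T. p i)" using N12 split[OF T] by (metis dvd_triv_left)
    ultimately have n1: "n1 dvd (\<Prod>i\<in>I - T. p i)" by (simp add: coprime_dvd_mult_left_iff)
    have "[int u ^ (\<Prod>i\<in>T. q i) = 1] (mod int n2)"
    proof (rule cong_dvd_modulus)
      show "[int u ^ (\<Prod>i\<in>T. q i) = 1] (mod int (\<Prod>i\<in>T. p i))" by (rule iffD2[OF uT[OF T] dvd_refl])
      show "int n2 dvd int (\<Prod>i\<in>T. p i)" using n2 by (simp only: int_dvd_int_iff)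
    qed
    hence "j dvd (\<Prod>i\<in>T. q i)" by (rule n(3))
    with n1 have "d dvd (\<Prod>i\<in>I - T. p i) * (\<Prod>i\<in>T. q i)" unfolding n(2) by (rule mult_dvd_mono)
    thus ?thesis using T by blast
  qed
  moreover have "(\<Prod>i\<in>I - T. p i) * (\<Prod>i\<in>T. q i) \<in> cd H" if T: "T \<subseteq> I" for T
  proof (rule degree_in_cd)
    show "int N = int (\<Prod>i\<in>I - T. p i) * int (\<Prod>i\<in>T. p i)"
      unfolding of_nat_mult[symmetric] using split[OF T] by (rule arg_cong)
  qed (rule qpos[OF T], rule uT[OF T])
  moreover obtain K :: "nat monoid" where "group K" "finite (carrier K)" "solvable K" "cd K = cd H"
    using solvable_group_on_nat[OF group_heis finite_heis solvable_heis] by blast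
  ultimately show ?thesis by (intro exI[of _ K] conjI) simp_all
qed

section \<open>The graph\<close>

lemma unique_non_neighbour:
  fixes \<Gamma> :: "'v pair_pre_digraph"
  assumes "n \<ge> 2" "pair_graph \<Gamma>" "card (pverts \<Gamma>) = n" "regular_graph (n - 2) \<Gamma>"
  shows "\<exists>\<tau>. \<forall>v\<in>pverts \<Gamma>. \<tau> v \<in> pverts \<Gamma> \<and> \<tau> v \<noteq> v \<and> \<tau> (\<tau> v) = v \<and>
           (\<forall>w\<in>pverts \<Gamma>. (v, w) \<in> parcs \<Gamma> \<longleftrightarrow> w \<noteq> v \<and> w \<noteq> \<tau> v)"
proof -
  interpret pair_graph \<Gamma> by fact
  let ?V = "pverts \<Gamma>"
  have "\<exists>x. ?V - {v} - {w. (v, w) \<in> parcs \<Gamma>} = {x}" if v: "v \<in> ?V" for v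
  proof -
    let ?N = "{w. (v, w) \<in> parcs \<Gamma>}"
    have "out_arcs (with_proj \<Gamma>) v = Pair v ` ?N" by (auto simp: out_arcs_def)
    moreover have "card (Pair v ` ?N) = card ?N" by (rule card_image) (simp add: inj_on_def)
    moreover have "card (out_arcs (with_proj \<Gamma>) v) = n - 2"
      using assms(4) v unfolding regular_graph_def out_degree_def by blast
    ultimately have "card ?N = n - 2" by (simp only:)
    moreover have "?N \<subseteq> ?V - {v}" using in_arcsD2 no_loops' by auto
    ultimately have "card (?V - {v} - ?N) = n - 1 - (n - 2)"
      using v assms(3) pair_finite_verts by (subst card_Diff_subset) (auto intro: finite_subset)
    hence "card (?V - {v} - ?N) = 1" using assms(1) by simp
    thus ?thesis by (auto simp: card_1_singleton_iff)
  qed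
  then obtain \<tau> where \<tau>: "\<And>v. v \<in> ?V \<Longrightarrow> ?V - {v} - {w. (v, w) \<in> parcs \<Gamma>} = {\<tau> v}" by metis
  have mem: "w = \<tau> v \<longleftrightarrow> w \<in> ?V \<and> w \<noteq> v \<and> (v, w) \<notin> parcs \<Gamma>" if "v \<in> ?V" for v w
    using \<tau>[OF that] by blast
  have sym: "(v, w) \<in> parcs \<Gamma> \<Longrightarrow> (w, v) \<in> parcs \<Gamma>" for v w
    using pair_sym_arcs by (auto simp: symmetric_def sym_def)
  have "\<tau> v \<in> ?V \<and> \<tau> v \<noteq> v \<and> \<tau> (\<tau> v) = v \<and>
      (\<forall>w\<in>?V. (v, w) \<in> parcs \<Gamma> \<longleftrightarrow> w \<noteq> v \<and> w \<noteq> \<tau> v)" if v: "v \<in> ?V" for v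
  proof -
    have 1: "\<tau> v \<in> ?V" "\<tau> v \<noteq> v" "(v, \<tau> v) \<notin> parcs \<Gamma>" using mem[OF v, of "\<tau> v"] by auto
    have "v = \<tau> (\<tau> v)" using mem[OF 1(1), of v] v 1 sym[of "\<tau> v" v] by metis
    thus ?thesis using 1 mem[OF v] no_loops' by metis
  qed
  thus ?thesis by blast
qed

theorem theorem3p6:
  fixes n :: nat and \<Gamma> :: "'v pair_pre_digraph"
  assumes "n \<ge> 4" and "even n"
    and "pair_graph \<Gamma>"
    and "card (pverts \<Gamma>) = n"
    and "regular_graph (n - 2) \<Gamma>"
  shows "\<exists>G :: nat monoid. group G \<and> finite (carrier G) \<and> solvable G \<and>
           digraph_iso (with_proj \<Gamma>) (with_proj (degree_graph G))"
proof -
  interpret pair_graph \<Gamma> by fact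
  let ?V = "pverts \<Gamma>"
  have "n \<ge> 2" using assms(1) by simp
  from unique_non_neighbour[OF this assms(3-5)] obtain \<tau> where
    "\<forall>v\<in>?V. \<tau> v \<in> ?V \<and> \<tau> v \<noteq> v \<and> \<tau> (\<tau> v) = v \<and>
      (\<forall>w\<in>?V. (v, w) \<in> parcs \<Gamma> \<longleftrightarrow> w \<noteq> v \<and> w \<noteq> \<tau> v)" by blast
  hence \<tau>: "\<And>v. v \<in> ?V \<Longrightarrow> \<tau> v \<in> ?V" "\<And>v. v \<in> ?V \<Longrightarrow> \<tau> v \<noteq> v" "\<And>v. v \<in> ?V \<Longrightarrow> \<tau> (\<tau> v) = v"
    and adj: "\<And>v w. v \<in> ?V \<Longrightarrow> w \<in> ?V \<Longrightarrow> (v, w) \<in> parcs \<Gamma> \<longleftrightarrow> w \<noteq> v \<and> w \<noteq> \<tau> v" by blast+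
  \<comment> \<open>\<open>I\<close> selects one vertex from each pair of non-neighbours.\<close>
  define c :: "'v set \<Rightarrow> 'v" where "c = (\<lambda>A. SOME w. w \<in> A)"
  have c: "c A \<in> A" if "A \<noteq> {}" for A unfolding c_def some_in_eq by (rule that)
  define I where "I = {v \<in> ?V. c {v, \<tau> v} = v}"
  have I: "I \<subseteq> ?V" "finite I" using pair_finite_verts by (auto simp: I_def)
  have I_iff: "\<tau> v \<in> I \<longleftrightarrow> v \<notin> I" if v: "v \<in> ?V" for v
  proof -
    have "{\<tau> v, \<tau> (\<tau> v)} = {v, \<tau> v}" using \<tau>(3)[OF v] by auto
    moreover have "c {v, \<tau> v} = v \<or> c {v, \<tau> v} = \<tau> v" using c[of "{v, \<tau> v}"] by auto
    ultimately show ?thesis using v \<tau>(1,2)[OF v] unfolding I_def by auto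
  qed
  obtain p q a :: "'v \<Rightarrow> nat" where
    pqa: "\<forall>i\<in>I. prime (p i) \<and> prime (q i) \<and> (\<forall>j. [a i ^ j = 1] (mod p i) \<longleftrightarrow> q i dvd j)"
    and inj: "inj_on p I" "inj_on q I" and disj: "p ` I \<inter> q ` I = {}"
    using prime_pairs_exist[OF I(2)] by (elim exE conjE)
  have pq: "prime (p i)" "prime (q i)" if "i \<in> I" for i
    using bspec[OF pqa that] by blast+
  obtain G :: "nat monoid" where G: "group G" "finite (carrier G)" "solvable G"
    and low: "\<forall>T\<subseteq>I. (\<Prod>i\<in>I - T. p i) * (\<Prod>i\<in>T. q i) \<in> cd G"
    and up: "\<forall>d\<in>cd G. \<exists>T\<subseteq>I. d dvd (\<Prod>i\<in>I - T. p i) * (\<Prod>i\<in>T. q i)"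
    using solvable_group_with_degrees[OF I(2) pqa inj] by (elim exE conjE)
  \<comment> \<open>A selected vertex goes to \<open>p\<close>, its non-neighbour to the partner \<open>q\<close>.\<close>
  define f where "f = (\<lambda>v. if v \<in> I then p v else q (\<tau> v))"
  have fprime: "prime (f v)" if "v \<in> ?V" for v using that pq I_iff by (auto simp: f_def)
  have finj: "inj_on f ?V"
  proof (rule inj_onI)
    fix v w assume vw: "v \<in> ?V" "w \<in> ?V" "f v = f w"
    show "v = w"
    proof (cases "v \<in> I"; cases "w \<in> I")
      assume "v \<in> I" "w \<in> I"
      thus ?thesis using vw inj by (auto simp: f_def inj_on_def)
    next
      assume vI: "v \<notin> I" "w \<notin> I"
      hence "\<tau> v = \<tau> w" using vw inj I_iff by (auto simp: f_def inj_on_def)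
      thus ?thesis using vw \<tau>(3) by metis
    qed (use vw disj I_iff in \<open>auto simp: f_def\<close>)
  qed
  have dvd_iff: "f v dvd (\<Prod>i\<in>I - T. p i) * (\<Prod>i\<in>T. q i) \<longleftrightarrow> (if v \<in> I then v \<notin> T else \<tau> v \<in> T)"
    if v: "v \<in> ?V" and T: "T \<subseteq> I" for v T
  proof -
    have fin: "finite T" "finite (I - T)" using T I finite_subset by auto
    have "f v dvd (\<Prod>i\<in>I - T. p i) * (\<Prod>i\<in>T. q i) \<longleftrightarrow> (\<exists>i\<in>I - T. f v dvd p i) \<or> (\<exists>i\<in>T. f v dvd q i)"
      by (simp only: prime_dvd_mult_iff[OF fprime[OF v]] prime_dvd_prod_iff[OF _ fprime[OF v]] fin)
    also have "\<dots> \<longleftrightarrow> (\<exists>i\<in>I - T. f v = p i) \<or> (\<exists>i\<in>T. f v = q i)"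
    proof -
      have "f v dvd p i \<longleftrightarrow> f v = p i" "f v dvd q i \<longleftrightarrow> f v = q i" if "i \<in> I" for i
        using primes_dvd_imp_eq[OF fprime[OF v] pq(1)[OF that]]
          primes_dvd_imp_eq[OF fprime[OF v] pq(2)[OF that]] by auto
      thus ?thesis using T by blast
    qed
    also have "\<dots> \<longleftrightarrow> (if v \<in> I then v \<notin> T else \<tau> v \<in> T)"
    proof (cases "v \<in> I")
      case True
      have "f v = p i \<longleftrightarrow> i = v" "f v \<noteq> q i" if "i \<in> I" for i
        using True that disj inj_on_eq_iff[OF inj(1) True that] by (auto simp: f_def)
      thus ?thesis using True T by auto
    next
      case False
      hence \<tau>I: "\<tau> v \<in> I" using I_iff v by simp
      have "f v = q i \<longleftrightarrow> i = \<tau> v" "f v \<noteq> p i" if "i \<in> I" for i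
        using False \<tau>I that disj inj_on_eq_iff[OF inj(2) \<tau>I that] by (auto simp: f_def)
      thus ?thesis using False \<tau>I T by auto
    qed
    finally show ?thesis .
  qed
  have rho: "rho G = f ` ?V"
  proof (intro equalityI subsetI)
    fix r assume "r \<in> rho G"
    then obtain d where r: "prime r" "d \<in> cd G" "r dvd d" by (auto simp: rho_def)
    then obtain T where T: "T \<subseteq> I" "r dvd (\<Prod>i\<in>I - T. p i) * (\<Prod>i\<in>T. q i)" using up dvd_trans by blast
    have fin: "finite T" "finite (I - T)" using T I finite_subset by auto
    have "(\<exists>i\<in>I - T. r dvd p i) \<or> (\<exists>i\<in>T. r dvd q i)"
      using T(2) by (simp only: prime_dvd_mult_iff[OF r(1)] prime_dvd_prod_iff[OF _ r(1)] fin)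
    hence "(\<exists>i\<in>I. r = p i) \<or> (\<exists>i\<in>I. r = q i)"
      using primes_dvd_imp_eq[OF r(1) pq(1)] primes_dvd_imp_eq[OF r(1) pq(2)] T(1) by blast
    thus "r \<in> f ` ?V"
    proof (elim disjE bexE)
      fix i assume "i \<in> I" "r = p i"
      thus ?thesis using I by (intro image_eqI[of _ _ i]) (auto simp: f_def)
    next
      fix i assume i: "i \<in> I" "r = q i"
      hence "\<tau> i \<notin> I" "\<tau> i \<in> ?V" "\<tau> (\<tau> i) = i" using I I_iff \<tau> by auto
      thus ?thesis using i by (intro image_eqI[of _ _ "\<tau> i"]) (auto simp: f_def)
    qed
  next
    fix r assume "r \<in> f ` ?V"
    then obtain v where v: "v \<in> ?V" "r = f v" by auto
    define T where "T = (if v \<in> I then {} else I)"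
    have T: "T \<subseteq> I" by (auto simp: T_def)
    have "r dvd (\<Prod>i\<in>I - T. p i) * (\<Prod>i\<in>T. q i)"
      unfolding v(2) dvd_iff[OF v(1) T] using I_iff[OF v(1)] by (simp add: T_def)
    thus "r \<in> rho G" using low T fprime v unfolding rho_def by blast
  qed
  have edge: "(\<exists>d\<in>cd G. f v * f w dvd d) \<longleftrightarrow> (v, w) \<in> parcs \<Gamma>"
    if v: "v \<in> ?V" and w: "w \<in> ?V" and vw: "v \<noteq> w" for v w
  proof
    assume "\<exists>d\<in>cd G. f v * f w dvd d"
    then obtain d where d: "d \<in> cd G" "f v * f w dvd d" by blast
    obtain T where T: "T \<subseteq> I" "d dvd (\<Prod>i\<in>I - T. p i) * (\<Prod>i\<in>T. q i)" using bspec[OF up d(1)] by blast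
    have dv: "f v dvd (\<Prod>i\<in>I - T. p i) * (\<Prod>i\<in>T. q i)"
      by (rule dvd_trans[OF dvd_mult_left[OF d(2)] T(2)])
    have dw: "f w dvd (\<Prod>i\<in>I - T. p i) * (\<Prod>i\<in>T. q i)"
      by (rule dvd_trans[OF dvd_mult_right[OF d(2)] T(2)])
    have "w \<noteq> \<tau> v"
    proof
      assume "w = \<tau> v"
      thus False using dv dw unfolding dvd_iff[OF v T(1)] dvd_iff[OF w T(1)]
        using I_iff[OF v] \<tau>(3)[OF v] by (auto split: if_splits)
    qed
    thus "(v, w) \<in> parcs \<Gamma>" using adj[OF v w] vw by simp
  next
    assume "(v, w) \<in> parcs \<Gamma>"
    hence wt: "w \<noteq> \<tau> v" using adj[OF v w] by simp
    \<comment> \<open>\<open>v\<close> and \<open>w\<close> lie in different pairs, so both choices between \<open>p\<close> and \<open>q\<close> can be made at once.\<close>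
    define T where "T = \<tau> ` ({v, w} - I)"
    have T: "T \<subseteq> I" using v w I_iff by (auto simp: T_def)
    have "v \<noteq> \<tau> w" using wt \<tau>(3)[OF w] by auto
    hence "f v dvd (\<Prod>i\<in>I - T. p i) * (\<Prod>i\<in>T. q i)" "f w dvd (\<Prod>i\<in>I - T. p i) * (\<Prod>i\<in>T. q i)"
      unfolding dvd_iff[OF v T] dvd_iff[OF w T] using v w wt I_iff \<tau> by (auto simp: T_def)
    moreover have "f v \<noteq> f w" using finj v w vw by (auto simp: inj_on_def)
    hence "coprime (f v) (f w)" using fprime v w by (intro primes_coprime) auto
    ultimately have "f v * f w dvd (\<Prod>i\<in>I - T. p i) * (\<Prod>i\<in>T. q i)" by (intro divides_mult)
    thus "\<exists>d\<in>cd G. f v * f w dvd d" using low T by blast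
  qed
  have arcs: "parcs (degree_graph G) = map_prod f f ` parcs \<Gamma>"
  proof (intro equalityI subrelI)
    fix r s assume "(r, s) \<in> parcs (degree_graph G)"
    hence rs: "r \<in> f ` ?V" "s \<in> f ` ?V" "r \<noteq> s" "\<exists>d\<in>cd G. r * s dvd d"
      by (auto simp: degree_graph_def rho)
    then obtain v w where vw: "v \<in> ?V" "w \<in> ?V" "r = f v" "s = f w" by blast
    hence "(v, w) \<in> parcs \<Gamma>" using edge[OF vw(1,2)] rs by blast
    thus "(r, s) \<in> map_prod f f ` parcs \<Gamma>" unfolding vw(3,4) by (rule map_prod_imageI)
  next
    fix r s assume "(r, s) \<in> map_prod f f ` parcs \<Gamma>"
    then obtain v w where vw: "(v, w) \<in> parcs \<Gamma>" "r = f v" "s = f w" by auto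
    have V: "v \<in> ?V" "w \<in> ?V" "v \<noteq> w" using vw(1) in_arcsD1 in_arcsD2 no_loops' by auto
    hence "f v \<noteq> f w" using finj by (auto simp: inj_on_def)
    thus "(r, s) \<in> parcs (degree_graph G)" using edge[OF V] V vw by (auto simp: degree_graph_def rho)
  qed
  let ?h = "\<lparr>iso_verts = f, iso_arcs = map_prod f f, iso_head = snd, iso_tail = fst\<rparr>"
  have "inj_on (map_prod f f) (parcs \<Gamma>)"
    using finj in_arcsD1 in_arcsD2 by (intro inj_onI) (auto dest!: inj_onD[OF finj])
  hence "pre_digraph.digraph_isomorphism (with_proj \<Gamma>) ?h"
    using finj wf_digraph by (auto simp: pre_digraph.digraph_isomorphism_def)
  moreover have "with_proj (degree_graph G) = app_iso ?h (with_proj \<Gamma>)"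
    using arcs rho by (auto simp: app_iso_def with_proj_def degree_graph_def)
  ultimately show ?thesis using G unfolding digraph_iso_def by blast
qed

end
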